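(* Let $T>0$, $x_0\in\mathbb{R}^n$, let $(\bar u(\cdot),\bar b(\cdot))$ with $x_0\in C_{(\bar u,\bar b)}(0)$ be a canonical control pair, and let $\bar x(\cdot)$ be the corresponding unique solution of the sweeping process $-\dot x(t)\in N_{C_{(\bar u,\bar b)}(t)}(x(t))$ a.e. $t\in[0,T]$, $x(0)=x_0$. Then there exist a sequence of meshes $$\Delta_k=\{0=t^k_0<t^k_1<\dots<t^k_{\nu(k)}=T\},\qquad h^k_j:=t^k_{j+1}-t^k_j\ \ (j=0,\dots,\nu(k)-1),$$ with mesh sizes $h^k_j\downarrow0$ as $k\to\infty$, a sequence of functions $(\widetilde u^k(\cdot),\widetilde b^k(\cdot),\widetilde x^k(\cdot))$ on $[0,T]$ that are piecewise linear with respect to $\Delta_k$, and a sequence of positive numbers $\delta_k\downarrow0$ such that $(\widetilde u^k(0),\widetilde b^k(0),\widetilde x^k(0))=(\bar u(0),\bar b(0),x_0)$, $$1-\delta_k\le\|\widetilde u^k_i(t^k_j)\|\le1+\delta_k\quad\text{for all }t^k_j\in\Delta_k,\ i=1,\dots,m,$$ $$\widetilde x^k(t)=\widetilde x^k(t^k_j)+(t-t^k_j)\widetilde v^k_j,\quad t^k_j\le t\le t^k_{j+1},\quad\text{with}\quad-\widetilde v^k_j\in F\big(\widetilde u^k(t^k_j),\widetilde b^k(t^k_j),\widetilde x^k(t^k_j)\big)$$ for $j=0,\dots,\nu(k)-1$ and $k\in\mathbb{N}$, and the sequence $\{(\widetilde u^k(\cdot),\widetilde b^k(\cdot),\widetilde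 x^k(\cdot))\}$ converges to $(\bar u(\cdot),\bar b(\cdot),\bar x(\cdot))$ as $k\to\infty$ in the $W^{1,2}$-norm topology on $[0,T]$.
   Context: The state space is $\mathbb{R}^n$. For $(u,b)\in\mathbb{R}^{nm}\times\mathbb{R}^m$, $u=(u_1,\dots,u_m)$ with $u_i\in\mathbb{R}^n$, put $C(u,b):=\{x\in\mathbb{R}^n\mid\langle u_i,x\rangle\le b_i,\ i=1,\dots,m\}$ and $F(u,b,x):=N_{C(u,b)}(x)$; for control functions, $C_{(u,b)}(t):=C(u(t),b(t))$. For convex $C$, $N_C(x):=\{v\mid\langle v,y-x\rangle\le0\ \forall y\in C\}$ if $x\in C$ and $N_C(x):=\emptyset$ otherwise. A control pair $(u,b)\in W^{1,2}([0,T],\mathbb{R}^{nm}\times\mathbb{R}^m)$ is called canonical if: (1) $u(\cdot)$ and $b(\cdot)$ are Lipschitz continuous on $[0,T]$; (2) the uniform Slater condition holds along $(u,b)$: for every $t\in[0,T]$ there is $x\in\mathbb{R}^n$ with $\langle u_i(t),x\rangle<b_i(t)$ for all $i=1,\dots,m$; (3) $\|u_i(t)\|=1$ for all $t\in[0,T]$, $i=1,\dots,m$; (4) the derivatives $\dot u(\cdot)$, $\dot b(\cdot)$ are of bounded variation on $[0,T]$, together with the derivative $\dot x(\cdot)$ of the unique Lipschitz continuous trajectory $x(\cdot)$ of the sweeping process $-\dot x(t)\in N_{C_{(u,b)}(t)}(x(t))$ a.e. $t\in[0,T]$, $x(0)=x_0\in C_{(u,b)}(0)$, generated by $(u,b)$.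 *)

theory Defs
  imports "HOL-Analysis.Analysis"
begin

subsection \<open>Controlled polyhedra and normal cones\<close>

definition polyhedron_of :: "(real^'n)^'m \<Rightarrow> real^'m \<Rightarrow> (real^'n) set" where
  "polyhedron_of u b = {x. \<forall>i. (u $ i) \<bullet> x \<le> b $ i}"

definition normal_cone :: "'a::real_inner set \<Rightarrow> 'a \<Rightarrow> 'a set" where
  "normal_cone C x = (if x \<in> C then {v. \<forall>y\<in>C. v \<bullet> (y - x) \<le> 0} else {})"

definition sweeping_map :: "(real^'n)^'m \<Rightarrow> real^'m \<Rightarrow> real^'n \<Rightarrow> (real^'n) set" where
  "sweeping_map u b x = normal_cone (polyhedron_of u b) x"


subsection \<open>The Sobolev space \<open>W\<^sup>1\<^sup>,\<^sup>2\<close> on \<open>[0, T]\<close>\<close>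

definition abs_continuous_upto :: "real \<Rightarrow> (real \<Rightarrow> 'a::real_normed_vector) \<Rightarrow> bool" where
  "abs_continuous_upto T f \<longleftrightarrow>
    (\<forall>e>0. \<exists>d>0. \<forall>(n::nat) (a::nat \<Rightarrow> real) (c::nat \<Rightarrow> real).
      (\<forall>i<n. 0 \<le> a i \<and> a i \<le> c i \<and> c i \<le> T) \<longrightarrow>
      (\<forall>i<n. \<forall>j<n. i \<noteq> j \<longrightarrow> {a i<..<c i} \<inter> {a j<..<c j} = {}) \<longrightarrow>
      (\<Sum>i<n. c i - a i) < d \<longrightarrow>
      (\<Sum>i<n. norm (f (c i) - f (a i))) < e)"

text \<open>The elements of \<open>W\<^sup>1\<^sup>,\<^sup>2\<close> are represented by their absolutely continuous representatives, so
  that point values make sense. The weak derivative is the almost everywhere classical one; the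
  value of \<^const>\<open>vector_derivative\<close> at points of non-differentiability, and the values
  of the functions outside \<open>[0, T]\<close>, are irrelevant.\<close>

definition W12 :: "real \<Rightarrow> (real \<Rightarrow> 'a::euclidean_space) set" where
  "W12 T = {f. abs_continuous_upto T f
     \<and> (AE t in lebesgue_on {0..T}. f differentiable (at t))
     \<and> (\<lambda>t. vector_derivative f (at t)) \<in> borel_measurable (lebesgue_on {0..T})
     \<and> integrable (lebesgue_on {0..T}) (\<lambda>t. (norm (vector_derivative f (at t)))\<^sup>2)}"

definition W12_norm :: "real \<Rightarrow> (real \<Rightarrow> 'a::euclidean_space) \<Rightarrow> real" where
  "W12_norm T f = sqrt ((LINT t|lebesgue_on {0..T}. (norm (f t))\<^sup>2)
     + (LINT t|lebesgue_on {0..T}. (norm (vector_derivative f (at t)))\<^sup>2))"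

text \<open>Membership in \<^const>\<open>W12\<close> is required explicitly, since the Bochner integrals in
  \<^const>\<open>W12_norm\<close> default to 0 for non-integrable functions.\<close>

definition W12_converges ::
    "real \<Rightarrow> (nat \<Rightarrow> real \<Rightarrow> 'a::euclidean_space) \<Rightarrow> (real \<Rightarrow> 'a) \<Rightarrow> bool" where
  "W12_converges T f g \<longleftrightarrow> (\<forall>k. f k \<in> W12 T) \<and> g \<in> W12 T
     \<and> (\<lambda>k. W12_norm T (\<lambda>t. f k t - g t)) \<longlonglongrightarrow> 0"


subsection \<open>Derivatives of bounded variation\<close>

definition bounded_variation_upto :: "real \<Rightarrow> (real \<Rightarrow> 'a::real_normed_vector) \<Rightarrow> bool" where
  "bounded_variation_upto T g \<longleftrightarrow>
    (\<exists>M. \<forall>(n::nat) (s::nat \<Rightarrow> real).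
      (\<forall>i\<le>n. s i \<in> {0..T}) \<longrightarrow> (\<forall>i<n. s i \<le> s (Suc i)) \<longrightarrow>
      (\<Sum>i<n. norm (g (s (Suc i)) - g (s i))) \<le> M)"

text \<open>The derivative of a Lipschitz function exists only almost everywhere; it is of bounded
  variation if it agrees almost everywhere with a function of bounded variation.\<close>

definition has_BV_derivative :: "real \<Rightarrow> (real \<Rightarrow> 'a::real_normed_vector) \<Rightarrow> bool" where
  "has_BV_derivative T f \<longleftrightarrow>
    (\<exists>g. bounded_variation_upto T g
       \<and> (AE t in lebesgue_on {0..T}. (f has_vector_derivative g t) (at t)))"


subsection \<open>Sweeping trajectories and canonical controls\<close>

definition sweeping_solution ::
    "real \<Rightarrow> (real \<Rightarrow> (real^'n)^'m) \<Rightarrow> (real \<Rightarrow> real^'m) \<Rightarrow> real^'n \<Rightarrow> (real \<Rightarrow> real^'n) \<Rightarrow> bool" where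
  "sweeping_solution T u b x0 x \<longleftrightarrow>
     (\<exists>L. L-lipschitz_on {0..T} x) \<and> x 0 = x0
     \<and> (AE t in lebesgue_on {0..T}. x differentiable (at t)
          \<and> - vector_derivative x (at t) \<in> normal_cone (polyhedron_of (u t) (b t)) (x t))"

definition uniform_Slater ::
    "real \<Rightarrow> (real \<Rightarrow> (real^'n)^'m) \<Rightarrow> (real \<Rightarrow> real^'m) \<Rightarrow> bool" where
  "uniform_Slater T u b \<longleftrightarrow> (\<forall>t\<in>{0..T}. \<exists>x. \<forall>i. (u t $ i) \<bullet> x < b t $ i)"

text \<open>In the last conjunct, \<open>x\<close> is the trajectory generated by \<open>(u, b)\<close>; it is unique as a
  function on \<open>[0, T]\<close>.\<close>

definition canonical_control ::
    "real \<Rightarrow> real^'n \<Rightarrow> (real \<Rightarrow> (real^'n)^'m) \<Rightarrow> (real \<Rightarrow> real^'m) \<Rightarrow> bool" where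
  "canonical_control T x0 u b \<longleftrightarrow>
     (\<lambda>t. (u t, b t)) \<in> W12 T
     \<and> (\<exists>L. L-lipschitz_on {0..T} u) \<and> (\<exists>L. L-lipschitz_on {0..T} b)
     \<and> uniform_Slater T u b
     \<and> (\<forall>t\<in>{0..T}. \<forall>i. norm (u t $ i) = 1)
     \<and> has_BV_derivative T u \<and> has_BV_derivative T b
     \<and> (\<exists>x. sweeping_solution T u b x0 x
          \<and> (\<forall>y. sweeping_solution T u b x0 y \<longrightarrow> (\<forall>t\<in>{0..T}. y t = x t))
          \<and> has_BV_derivative T x)"


subsection \<open>Meshes and piecewise linear functions\<close>

text \<open>A mesh is given by the number \<open>N\<close> of subintervals and the nodes \<open>s 0, \<dots>, s N\<close>.\<close>

definition is_mesh :: "real \<Rightarrow> nat \<Rightarrow> (nat \<Rightarrow> real) \<Rightarrow> bool" where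
  "is_mesh T N s \<longleftrightarrow> s 0 = 0 \<and> s N = T \<and> (\<forall>j<N. s j < s (Suc j))"

definition mesh_size :: "nat \<Rightarrow> (nat \<Rightarrow> real) \<Rightarrow> real" where
  "mesh_size N s = Max ((\<lambda>j. s (Suc j) - s j) ` {..<N})"

definition piecewise_linear_on_mesh ::
    "nat \<Rightarrow> (nat \<Rightarrow> real) \<Rightarrow> (real \<Rightarrow> 'a::real_vector) \<Rightarrow> bool" where
  "piecewise_linear_on_mesh N s f \<longleftrightarrow>
     (\<forall>j<N. \<exists>w. \<forall>t\<in>{s j..s (Suc j)}. f t = f (s j) + (t - s j) *\<^sub>R w)"

definition decreases_to_0 :: "(nat \<Rightarrow> real) \<Rightarrow> bool" where
  "decreases_to_0 a \<longleftrightarrow> decseq a \<and> a \<longlonglongrightarrow> 0"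

end

(* Take mesh nodes t_j (j >= 1) at which -xbar'(t_j) lies in the normal cone of C(t_j) at xbar(t_j),
   let x be the Euler polygon with velocities v_0 = 0 and v_j = xbar'(t_j), put u_j = ubar(t_j), and
   correct b so that the polyhedron is translated by the error e_j = x(t_j) - xbar(t_j):
   b_j = bbar(t_j) + (<ubar_i(t_j), e_j>)_i.  Translation preserves normal cones, so the discrete
   inclusion is exact.  Since xbar' has bounded variation it is continuous almost everywhere, so the
   velocities converge to xbar' almost everywhere, whence e_j -> 0 uniformly; the slopes of u and b
   are difference quotients straddling t plus error terms that vanish.  All derivatives are uniformly
   bounded, and dominated convergence gives convergence in W^{1,2}. *)

theory Submission
  imports Defs
begin

subsection \<open>Derivatives of Lipschitz functions\<close>

text \<open>Piecewise linear interpolation of xbar would also converge, but its slopes are averages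
  of normals taken at different times and need not lie in the normal cone at the node. A velocity
  sampled at the node is a genuine normal there; the price is a polygon that drifts away from xbar,
  and the control must absorb the drift. It is absorbed by b alone, so that the rows of u keep norm
  exactly one at all nodes. Sampling is a pointwise operation, while a general L^2 derivative is
  only determined up to null sets and may be discontinuous everywhere. Bounded variation provides a
  representative g of xbar' with at most countably many discontinuities, and the point values of
  this representative are the ones sampled. Convergence in W^{1,2} also requires the slopes of the
  correction to vanish, which does not follow from e_j -> 0. It holds because the slope of e_j is
  v_j minus the slope of xbar on the same cell, and both tend to xbar'(t). A discrete product rule
  then separates a term containing e from a term containing this difference.\<close>

lemma AE_lebesgue_on_iff:
  assumes "S \<in> sets lebesgue"
  shows "(AE t in lebesgue_on S. P t) \<longleftrightarrow> (AE t in lebesgue. t \<in> S \<longrightarrow> P t)"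
  using assms by (simp add: AE_restrict_space_iff)

lemma AE_lebesgue_on_subset:
  assumes "AE t in lebesgue_on S. P t" "R \<subseteq> S" "S \<in> sets lebesgue" "R \<in> sets lebesgue"
  shows "AE t in lebesgue_on R. P t"
  using assms(1,2) unfolding AE_lebesgue_on_iff[OF assms(3)] AE_lebesgue_on_iff[OF assms(4)]
  by (auto elim!: eventually_mono)

lemma AE_lebesgue_on_countable:
  assumes "countable N" "S \<in> sets lebesgue"
  shows "AE t in lebesgue_on S. t \<notin> N"
proof -
  have "N \<in> null_sets lebesgue"
    using assms by (simp add: countable_imp_null_set_lborel null_sets_completionI)
  then have "AE t in lebesgue. t \<notin> N" by (rule AE_not_in)
  then show ?thesis unfolding AE_lebesgue_on_iff[OF assms(2)] by (auto elim!: eventually_mono)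
qed

lemma AE_lebesgue_on_interior_interval:
  "AE t in lebesgue_on {a..c::real}. t \<in> {a<..<c}"
proof -
  have "AE t in lebesgue_on {a..c}. t \<notin> {a,c}" by (rule AE_lebesgue_on_countable) auto
  moreover have "AE t in lebesgue_on {a..c}. t \<in> {a..c}" by (rule AE_I2) simp
  ultimately show ?thesis by eventually_elim auto
qed

text \<open>A nondegenerate interval has positive measure, so the exceptional null set cannot
  contain it. This is how mesh nodes with an almost everywhere property are found.\<close>

lemma AE_lebesgue_on_exists:
  fixes a :: real
  assumes "AE t in lebesgue_on S. P t" "S \<in> sets lebesgue" "a < c" "{a<..<c} \<subseteq> S"
  shows "\<exists>t. a < t \<and> t < c \<and> P t"
proof (rule ccontr)
  assume "\<nexists>t. a < t \<and> t < c \<and> P t"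
  then have n: "\<And>t. t \<in> {a<..<c} \<Longrightarrow> \<not> P t" by auto
  have "AE t in lebesgue_on {a<..<c}. P t"
    using AE_lebesgue_on_subset[OF assms(1,4,2)] by simp
  then have "AE t in lebesgue. t \<notin> {a<..<c}"
    by (subst (asm) AE_lebesgue_on_iff) (use n in \<open>auto elim!: eventually_mono\<close>)
  then have "{a<..<c} \<in> null_sets lebesgue"
    by (subst (asm) AE_iff_null_sets[symmetric]) auto
  then show False using \<open>a < c\<close> by (simp add: null_sets_def)
qed

text \<open>This is completeness of Lebesgue measure; extension by zero transfers it from the whole
  line to \<open>S\<close>.\<close>

lemma borel_measurable_lebesgue_on_AE:
  fixes f g :: "real \<Rightarrow> 'b::euclidean_space"
  assumes "f \<in> borel_measurable (lebesgue_on S)" "S \<in> sets lebesgue"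
    and "AE x in lebesgue_on S. f x = g x"
  shows "g \<in> borel_measurable (lebesgue_on S)"
proof -
  have "(\<lambda>x. if x \<in> S then g x else 0) \<in> borel_measurable lebesgue"
  proof (rule borel_measurable_AE)
    show "(\<lambda>x. if x \<in> S then f x else 0) \<in> borel_measurable lebesgue"
      using assms by (simp add: borel_measurable_if)
    show "AE x in lebesgue. (if x \<in> S then f x else 0) = (if x \<in> S then g x else 0)"
      using assms(3) unfolding AE_lebesgue_on_iff[OF assms(2)] by (auto elim!: eventually_mono)
  qed
  then show ?thesis using assms by (simp add: borel_measurable_if)
qed

lemma finite_measure_lebesgue_on_Icc: "finite_measure (lebesgue_on {a..c::real})"
  by (rule finite_measureI) (cases "a \<le> c"; simp add: emeasure_restrict_space)

lemma integrable_lebesgue_on_bounded: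
  fixes f :: "real \<Rightarrow> 'b::euclidean_space"
  assumes "f \<in> borel_measurable (lebesgue_on {a..c})" "AE t in lebesgue_on {a..c}. norm (f t) \<le> B"
  shows "integrable (lebesgue_on {a..c}) f"
  by (rule finite_measure.integrable_const_bound[OF finite_measure_lebesgue_on_Icc]) (use assms in auto)

section \<open>Difference quotients at a point of differentiability\<close>

lemma tendsto_difference_quotient:
  fixes f :: "real \<Rightarrow> 'b::real_normed_vector"
  assumes "(f has_vector_derivative D) (at t)"
  shows "((\<lambda>y. (f y - f t) /\<^sub>R (y - t)) \<longlongrightarrow> D) (at t)"
proof -
  have "((\<lambda>y. norm (f y - f t - (y - t) *\<^sub>R D) / norm (y - t)) \<longlongrightarrow> 0) (at t)"
    using assms unfolding has_vector_derivative_def has_derivative_iff_norm by auto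
  moreover have "eventually (\<lambda>y. norm (f y - f t - (y - t) *\<^sub>R D) / norm (y - t)
      = norm ((f y - f t) /\<^sub>R (y - t) - D)) (at t)"
  proof -
    have "norm (f y - f t - (y - t) *\<^sub>R D) / norm (y - t) = norm ((f y - f t) /\<^sub>R (y - t) - D)"
      if "y \<noteq> t" for y
    proof -
      have "(f y - f t) /\<^sub>R (y - t) - D = (f y - f t - (y - t) *\<^sub>R D) /\<^sub>R (y - t)"
        using that by (simp add: scaleR_diff_right)
      then show ?thesis by (simp only: norm_scaleR real_norm_def abs_inverse divide_inverse mult.commute)
    qed
    then show ?thesis by (auto simp: eventually_at intro: exI[of _ 1])
  qed
  ultimately have "((\<lambda>y. norm ((f y - f t) /\<^sub>R (y - t) - D)) \<longlongrightarrow> 0) (at t)"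
    using tendsto_cong by force
  then show ?thesis using tendsto_norm_zero_iff LIM_zero_iff by blast
qed

text \<open>The quotient on the left is the convex combination of \<open>X /\<^sub>R p\<close> and
  \<open>Y /\<^sub>R q\<close> with weights \<open>p / (p + q)\<close> and
  \<open>q / (p + q)\<close>, so its distance from \<open>D\<close> is at most the weighted mean of
  the two distances.\<close>

lemma norm_weighted_quotient_le:
  fixes X Y D :: "'b::real_normed_vector"
  assumes "0 < p" "0 < q"
  shows "norm ((X + Y) /\<^sub>R (p + q) - D) \<le> norm (X /\<^sub>R p - D) + norm (Y /\<^sub>R q - D)"
proof -
  define R where "R = X /\<^sub>R p - D"
  define S where "S = Y /\<^sub>R q - D"
  have "X = p *\<^sub>R (R + D)" "Y = q *\<^sub>R (S + D)"
    using assms by (simp_all add: R_def S_def)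
  then have "X + Y = p *\<^sub>R R + q *\<^sub>R S + (p + q) *\<^sub>R D"
    by (simp add: scaleR_add_right scaleR_add_left)
  then have "norm ((X + Y) /\<^sub>R (p + q) - D) = norm (p *\<^sub>R R + q *\<^sub>R S) / (p + q)"
    using assms by (simp add: scaleR_add_right[of "inverse (p + q)" _ "(p + q) *\<^sub>R D"] divide_inverse)
  also have "\<dots> \<le> (p * norm R + q * norm S) / (p + q)"
    using norm_triangle_ineq[of "p *\<^sub>R R" "q *\<^sub>R S"] assms by (intro divide_right_mono) auto
  also have "\<dots> \<le> norm R + norm S"
    using assms by (simp add: divide_le_eq ring_distribs)
  finally show ?thesis unfolding R_def S_def .
qed

text \<open>Splitting the increment at \<open>t\<close> makes the quotient a convex combination of
  the two one-sided quotients at \<open>t\<close>. The strict position of \<open>t\<close> between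
  \<open>a k\<close> and \<open>c k\<close> matters: for two points on the same side the weights
  could be unbounded, and differentiability at \<open>t\<close> alone would not suffice.\<close>

lemma tendsto_straddling_quotient:
  fixes f :: "real \<Rightarrow> 'b::real_normed_vector"
  assumes der: "(f has_vector_derivative D) (at t)"
    and ac: "\<And>k. a k < t" "\<And>k. t < c k" "a \<longlonglongrightarrow> t" "c \<longlonglongrightarrow> t"
  shows "(\<lambda>k. (f (c k) - f (a k)) /\<^sub>R (c k - a k)) \<longlonglongrightarrow> D"
proof -
  define r where "r y = norm ((f y - f t) /\<^sub>R (y - t) - D)" for y
  have r: "(r \<longlongrightarrow> 0) (at t)"
    unfolding r_def by (intro tendsto_norm_zero LIM_zero tendsto_difference_quotient der)
  have "filterlim a (at t) sequentially" "filterlim c (at t) sequentially"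
    using ac less_imp_neq[OF ac(1)] less_imp_neq[OF ac(2), symmetric] by (auto simp: filterlim_at)
  then have "(\<lambda>k. r (c k)) \<longlonglongrightarrow> 0" "(\<lambda>k. r (a k)) \<longlonglongrightarrow> 0"
    using filterlim_compose[OF r] by auto
  then have lim: "(\<lambda>k. r (c k) + r (a k)) \<longlonglongrightarrow> 0"
    by (rule tendsto_add_zero)
  have le: "norm ((f (c k) - f (a k)) /\<^sub>R (c k - a k) - D) \<le> r (c k) + r (a k)" for k
  proof -
    have "r (a k) = norm ((f t - f (a k)) /\<^sub>R (t - a k) - D)"
      unfolding r_def by (metis inverse_minus_eq minus_diff_eq scaleR_minus_left scaleR_minus_right)
    then show ?thesis
      using norm_weighted_quotient_le[of "c k - t" "t - a k" "f (c k) - f t" "f t - f (a k)" D] ac(1)[of k] ac(2)[of k]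
      by (simp add: r_def)
  qed
  have "(\<lambda>k. (f (c k) - f (a k)) /\<^sub>R (c k - a k) - D) \<longlonglongrightarrow> 0"
    using le lim by (rule Lim_null_comparison[OF always_eventually[OF allI]])
  then show ?thesis by (rule LIM_zero_cancel)
qed

lemma lipschitz_on_quotient_le:
  fixes f :: "real \<Rightarrow> 'b::real_normed_vector"
  assumes "L-lipschitz_on S f" "a \<in> S" "c \<in> S"
  shows "norm ((f c - f a) /\<^sub>R (c - a)) \<le> L"
proof (cases "a = c")
  case True
  then show ?thesis using assms(1) by (simp add: lipschitz_on_nonneg)
next
  case False
  then have "norm ((f c - f a) /\<^sub>R (c - a)) = norm (f c - f a) / \<bar>c - a\<bar>"
    by (simp only: norm_scaleR abs_inverse divide_inverse mult.commute)
  with False show ?thesis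
    using lipschitz_onD[OF assms(1,3,2)] by (simp add: dist_norm divide_le_eq)
qed

lemma norm_lipschitz_on_Icc_le:
  assumes "L-lipschitz_on {0..T} f" "t \<in> {0..T}"
  shows "norm (f t) \<le> norm (f 0) + L * T"
proof -
  have "norm (f t - f 0) \<le> L * \<bar>t\<bar>"
    using lipschitz_onD[OF assms, of 0] assms(2) by (simp add: dist_norm)
  also have "\<dots> \<le> L * T"
    using assms lipschitz_on_nonneg[OF assms(1)] by (intro mult_left_mono) auto
  finally show ?thesis using norm_triangle_sub[of "f t" "f 0"] by simp
qed

text \<open>Fundamental theorem of calculus for Lipschitz functions: by dominated convergence the
  integral of the derivative is the limit of the integrals of the (uniformly bounded) difference
  quotients, and those are explicit in terms of an antiderivative.\<close>

lemma lipschitz_AE_derivative: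
  fixes f D :: "real \<Rightarrow> 'b::euclidean_space"
  assumes lip: "L-lipschitz_on {0..T} f" and "0 \<le> T"
    and der: "AE t in lebesgue_on {0..T}. (f has_vector_derivative D t) (at t)"
  shows "D \<in> borel_measurable (lebesgue_on {0..T})"
    and "AE t in lebesgue_on {0..T}. norm (D t) \<le> L"
    and "\<And>c. c \<in> {0..T} \<Longrightarrow> integral\<^sup>L (lebesgue_on {0..c}) D = f c - f 0"
proof -
  \<comment> \<open>Constant continuation keeps the Lipschitz constant and makes the forward
    quotients meaningful up to \<open>T\<close> and beyond.\<close>
  define F where "F t = f (max 0 (min T t))" for t
  have F: "L-lipschitz_on UNIV F"
    unfolding lipschitz_on_def
  proof (intro conjI ballI)
    show "0 \<le> L" using lip by (rule lipschitz_on_nonneg)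
    fix x y
    have "dist (F x) (F y) \<le> L * dist (max 0 (min T x)) (max 0 (min T y))"
      unfolding F_def using \<open>0 \<le> T\<close> by (intro lipschitz_onD[OF lip]) auto
    also have "\<dots> \<le> L * dist x y"
      using \<open>0 \<le> L\<close> by (intro mult_left_mono) (auto simp: dist_real_def)
    finally show "dist (F x) (F y) \<le> L * dist x y" .
  qed
  then have contF: "continuous_on S F" for S
    using lipschitz_on_continuous_on continuous_on_subset by blast
  define h where "h n = 1 / (real n + 1)" for n
  have h0: "h n > 0" for n by (simp add: h_def)
  have hlim: "h \<longlonglongrightarrow> 0" unfolding h_def using LIMSEQ_inverse_real_of_nat by (simp add: field_simps)
  define q where "q n t = (F (t + h n) - F t) /\<^sub>R h n" for n t
  have qcont: "continuous_on S (q n)" for n S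
    unfolding q_def by (intro continuous_intros continuous_on_compose2[OF contF[of UNIV]]) auto
  have qm: "q n \<in> borel_measurable (lebesgue_on {0..c})" for n c
    by (intro continuous_imp_measurable_on_sets_lebesgue qcont) auto
  have qL: "norm (q n t) \<le> L" for n t
    using lipschitz_on_quotient_le[OF F, of t "t + h n"] by (simp add: q_def)
  have qlim: "AE t in lebesgue_on {0..T}. (\<lambda>n. q n t) \<longlonglongrightarrow> D t"
    using der AE_lebesgue_on_interior_interval[of 0 T]
  proof eventually_elim
    case (elim t)
    have "(F has_vector_derivative D t) (at t)"
      by (rule has_vector_derivative_transform_within_open[OF elim(1), of "{0<..<T}"])
        (use elim in \<open>auto simp: F_def\<close>)
    then have "((\<lambda>y. (F y - F t) /\<^sub>R (y - t)) \<longlongrightarrow> D t) (at t)"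
      by (rule tendsto_difference_quotient)
    moreover have "filterlim (\<lambda>n. t + h n) (at t) sequentially"
      using tendsto_add[OF tendsto_const[of t] hlim] h0
      by (auto simp: filterlim_at intro!: always_eventually) (metis less_irrefl)
    ultimately have "(\<lambda>n. (F (t + h n) - F t) /\<^sub>R (t + h n - t)) \<longlonglongrightarrow> D t"
      by (rule filterlim_compose)
    then show ?case by (simp add: q_def)
  qed
  have "(\<lambda>t. lim (\<lambda>n. q n t)) \<in> borel_measurable (lebesgue_on {0..T})"
    by (rule borel_measurable_lim_metric) (rule qm)
  then show Dm: "D \<in> borel_measurable (lebesgue_on {0..T})"
    by (rule borel_measurable_lebesgue_on_AE) (use qlim in \<open>auto elim!: eventually_mono simp: limI\<close>)
  show "AE t in lebesgue_on {0..T}. norm (D t) \<le> L"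
    using qlim by eventually_elim (rule Lim_norm_ubound[OF sequentially_bot], auto simp: qL)
  fix c assume c: "c \<in> {0..T}"
  \<comment> \<open>The difference quotient of \<open>G\<close> with step \<open>h n\<close> is an
    antiderivative of \<open>q n\<close>, and its values at \<open>c\<close> and \<open>0\<close>
    tend to \<open>F c\<close> and \<open>F 0\<close>. Starting the integral at -1 makes 0 an
    interior point, so \<open>G\<close> has a two-sided derivative there.\<close>
  define G where "G t = integral {-1..t} F" for t
  have G: "(G has_vector_derivative F t) (at t)" if "t \<ge> 0" for t
  proof -
    have "(G has_vector_derivative F t) (at t within {-1..t+1})"
      unfolding G_def using that by (intro integral_has_vector_derivative contF) auto
    then show ?thesis using that by (subst (asm) at_within_interior) auto
  qed
  have quot: "((\<lambda>n. (G (t + h n) - G t) /\<^sub>R h n) \<longlonglongrightarrow> F t)" if "t \<ge> 0" for t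
  proof -
    have "filterlim (\<lambda>n. t + h n) (at t) sequentially"
      using tendsto_add[OF tendsto_const[of t] hlim] h0
      by (auto simp: filterlim_at intro!: always_eventually) (metis less_irrefl)
    from filterlim_compose[OF tendsto_difference_quotient[OF G[OF that]] this]
    show ?thesis by simp
  qed
  have qint: "integral\<^sup>L (lebesgue_on {0..c}) (q n)
      = (G (c + h n) - G c) /\<^sub>R h n - (G (0 + h n) - G 0) /\<^sub>R h n" for n
  proof -
    have "((\<lambda>t. (G (t + h n) - G t) /\<^sub>R h n) has_vector_derivative q n t) (at t within {0..c})"
      if "t \<in> {0..c}" for t
    proof -
      have "((\<lambda>t. t + h n) has_real_derivative 1) (at t)" by (auto intro!: derivative_eq_intros)
      then have "((G \<circ> (\<lambda>t. t + h n)) has_vector_derivative 1 *\<^sub>R F (t + h n)) (at t)"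
        using that h0[of n]
        by (intro vector_diff_chain_at G) (auto simp: has_real_derivative_iff_has_vector_derivative)
      then have "((\<lambda>t. G (t + h n)) has_vector_derivative F (t + h n)) (at t)" by (simp add: o_def)
      from has_vector_derivative_diff[OF this G] that
      have "((\<lambda>t. G (t + h n) - G t) has_vector_derivative F (t + h n) - F t) (at t)" by auto
      then show ?thesis unfolding q_def
        using bounded_linear.has_vector_derivative[OF bounded_linear_scaleR_right]
        by (blast intro: has_vector_derivative_at_within)
    qed
    then have "(q n has_integral ((G (c + h n) - G c) /\<^sub>R h n - (G (0 + h n) - G 0) /\<^sub>R h n)) {0..c}"
      using c by (intro fundamental_theorem_of_calculus) auto
    moreover have "integrable (lebesgue_on {0..c}) (q n)"
      by (rule integrable_lebesgue_on_bounded[OF qm, where B=L]) (simp add: qL)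
    ultimately show ?thesis by (simp add: lebesgue_integral_eq_integral integral_unique)
  qed
  have "(\<lambda>n. integral\<^sup>L (lebesgue_on {0..c}) (q n)) \<longlonglongrightarrow> integral\<^sup>L (lebesgue_on {0..c}) D"
  proof (rule integral_dominated_convergence[where w="\<lambda>_. L"])
    show "D \<in> borel_measurable (lebesgue_on {0..c})"
      using Dm by (rule measurable_restrict_mono) (use c in auto)
    show "integrable (lebesgue_on {0..c}) (\<lambda>_. L)"
      by (rule finite_measure.integrable_const[OF finite_measure_lebesgue_on_Icc])
    show "AE t in lebesgue_on {0..c}. (\<lambda>n. q n t) \<longlonglongrightarrow> D t"
      by (rule AE_lebesgue_on_subset[OF qlim]) (use c in auto)
  qed (use qL qm in auto)
  moreover have "(\<lambda>n. integral\<^sup>L (lebesgue_on {0..c}) (q n)) \<longlonglongrightarrow> F c - F 0"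
    unfolding qint using c by (intro tendsto_diff quot) auto
  ultimately show "integral\<^sup>L (lebesgue_on {0..c}) D = f c - f 0"
    using LIMSEQ_unique c by (fastforce simp: F_def)
qed

text \<open>A monotone function has only countably many discontinuities, and a countable set is
  null. Continuity within \<open>{0..T}\<close> is the form needed for sampling, since all mesh
  nodes lie in that interval.\<close>

lemma AE_continuous_if_bounded_variation_upto:
  fixes g :: "real \<Rightarrow> 'b::real_normed_vector"
  assumes "bounded_variation_upto T g" "0 \<le> T"
  shows "AE t in lebesgue_on {0..T}. continuous (at t within {0..T}) g"
    and "\<exists>M. \<forall>t\<in>{0..T}. norm (g t) \<le> M"
proof -
  obtain M where M: "\<And>n s. \<lbrakk>\<And>i. i \<le> n \<Longrightarrow> s i \<in> {0..T}; \<And>i. i < n \<Longrightarrow> s i \<le> s (Suc i)\<rbrakk> \<Longrightarrow>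
      (\<Sum>i<n. norm (g (s (Suc i)) - g (s i))) \<le> M" for n :: nat and s :: "nat \<Rightarrow> real"
    using assms(1) unfolding bounded_variation_upto_def by blast
  define P where "P t = {(n::nat, s::nat \<Rightarrow> real). (\<forall>i\<le>n. s i \<in> {0..t}) \<and> (\<forall>i<n. s i \<le> s (Suc i))}" for t
  define S where "S p = (\<Sum>i<fst p. norm (g (snd p (Suc i)) - g (snd p i)))" for p :: "nat \<times> (nat \<Rightarrow> real)"
  define V where "V t = (SUP p\<in>P t. S p)" for t
  have bdd: "bdd_above (S ` P t)" if "t \<in> {0..T}" for t
  proof (rule bdd_aboveI2)
    fix p assume "p \<in> P t"
    then show "S p \<le> M"
      using that unfolding S_def by (intro M) (force simp: P_def)+
  qed
  have ne: "P t \<noteq> {}" if "t \<in> {0..T}" for t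
    using that by (auto simp: P_def intro!: exI[of _ 0] exI[of _ "\<lambda>_. 0"])
  text \<open>The variation function \<open>V\<close> is monotone and dominates the increments of \<open>g\<close>, so \<open>g\<close> is
    continuous wherever \<open>V\<close> is.\<close>
  have V: "norm (g c - g a) \<le> V c - V a" if "a \<in> {0..T}" "c \<in> {0..T}" "a \<le> c" for a c
  proof -
    have "S p \<le> V c - norm (g c - g a)" if "p \<in> P a" for p
    proof -
      obtain n s where p: "p = (n, s)" by (cases p)
      \<comment> \<open>Chains in \<open>P a\<close> need not end at \<open>a\<close>, so both
        \<open>a\<close> and \<open>c\<close> are appended; the increment from \<open>s n\<close> to
        \<open>a\<close> is nonnegative and is dropped afterwards.\<close>
      define s' where "s' i = (if i \<le> n then s i else if i = Suc n then a else c)" for i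
      have "(Suc (Suc n), s') \<in> P c"
        using that \<open>a \<le> c\<close> \<open>a \<in> {0..T}\<close> unfolding p P_def s'_def by (auto simp: le_Suc_eq less_Suc_eq)
      then have "S (Suc (Suc n), s') \<le> V c"
        unfolding V_def using bdd[OF \<open>c \<in> _\<close>] by (rule cSUP_upper)
      moreover have "S p = (\<Sum>i<n. norm (g (s' (Suc i)) - g (s' i)))"
        unfolding S_def p by (auto simp: s'_def intro!: sum.cong)
      ultimately have "S p + norm (g a - g (s n)) + norm (g c - g a) \<le> V c"
        by (simp add: S_def s'_def)
      then show ?thesis using norm_ge_zero[of "g a - g (s n)"] by linarith
    qed
    then have "V a \<le> V c - norm (g c - g a)"
      unfolding V_def[of a] using ne[OF \<open>a \<in> _\<close>] by (intro cSUP_least)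
    then show ?thesis by simp
  qed
  have "mono_on {0..T} V"
    using V by (intro mono_onI) (smt (verit) norm_ge_zero)
  then have "countable {a\<in>{0..T}. \<not> continuous (at a within {0..T}) V}"
    by (rule mono_on_ctble_discont)
  then have "AE t in lebesgue_on {0..T}. t \<notin> {a\<in>{0..T}. \<not> continuous (at a within {0..T}) V}"
    by (rule AE_lebesgue_on_countable) auto
  moreover have "AE t in lebesgue_on {0..T}. t \<in> {0..T}" by (rule AE_I2) simp
  ultimately show "AE t in lebesgue_on {0..T}. continuous (at t within {0..T}) g"
  proof eventually_elim
    case (elim t)
    then have "(V \<longlongrightarrow> V t) (at t within {0..T})" by (simp add: continuous_within)
    then have "((\<lambda>s. \<bar>V s - V t\<bar>) \<longlongrightarrow> 0) (at t within {0..T})"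
      using LIM_zero tendsto_rabs_zero by blast
    moreover have "norm (g s - g t) \<le> \<bar>V s - V t\<bar>" if "s \<in> {0..T}" for s
      using V[of s t] V[of t s] that elim by (cases "s \<le> t") (auto simp: norm_minus_commute)
    then have "eventually (\<lambda>s. norm (g s - g t) \<le> \<bar>V s - V t\<bar>) (at t within {0..T})"
      by (auto simp: eventually_at_filter intro!: always_eventually)
    ultimately have "((\<lambda>s. g s - g t) \<longlongrightarrow> 0) (at t within {0..T})"
      by (rule Lim_null_comparison[rotated])
    then show ?case by (simp add: continuous_within LIM_zero_iff)
  qed
  have "norm (g t) \<le> norm (g 0) + (V T - V 0)" if "t \<in> {0..T}" for t
    using V[of 0 t] V[of t T] that norm_triangle_sub[of "g t" "g 0"] norm_ge_zero[of "g T - g t"]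
    by (auto simp del: norm_ge_zero)
  then show "\<exists>M. \<forall>t\<in>{0..T}. norm (g t) \<le> M" by blast
qed

subsection \<open>Convergence in \<open>W\<^sup>1\<^sup>,\<^sup>2\<close> from almost everywhere convergence of derivatives\<close>

lemma abs_continuous_upto_lipschitz:
  assumes "L-lipschitz_on {0..T} f"
  shows "abs_continuous_upto T f"
  unfolding abs_continuous_upto_def
proof (intro allI impI)
  fix e :: real assume "e > 0"
  have L: "L \<ge> 0" using assms by (rule lipschitz_on_nonneg)
  show "\<exists>d>0. \<forall>(n::nat) (a::nat \<Rightarrow> real) (c::nat \<Rightarrow> real).
      (\<forall>i<n. 0 \<le> a i \<and> a i \<le> c i \<and> c i \<le> T) \<longrightarrow>
      (\<forall>i<n. \<forall>j<n. i \<noteq> j \<longrightarrow> {a i<..<c i} \<inter> {a j<..<c j} = {}) \<longrightarrow>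
      (\<Sum>i<n. c i - a i) < d \<longrightarrow>
      (\<Sum>i<n. norm (f (c i) - f (a i))) < e"
  \<comment> \<open>The summand 1 covers the case \<open>L = 0\<close>.\<close>
  proof (rule exI[of _ "e / (L + 1)"], intro conjI allI impI)
    show "e / (L + 1) > 0" using \<open>e > 0\<close> L by simp
    fix n :: nat and a c :: "nat \<Rightarrow> real"
    assume ac: "\<forall>i<n. 0 \<le> a i \<and> a i \<le> c i \<and> c i \<le> T"
      and d: "(\<Sum>i<n. c i - a i) < e / (L + 1)"
    have "(\<Sum>i<n. norm (f (c i) - f (a i))) \<le> (\<Sum>i<n. L * (c i - a i))"
    proof (rule sum_mono)
      fix i assume "i \<in> {..<n}"
      with ac show "norm (f (c i) - f (a i)) \<le> L * (c i - a i)"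
        using lipschitz_onD[OF assms, of "c i" "a i"] by (auto simp: dist_norm)
    qed
    also have "\<dots> = L * (\<Sum>i<n. c i - a i)" by (simp add: sum_distrib_left)
    also have "\<dots> \<le> (L + 1) * (\<Sum>i<n. c i - a i)"
      by (intro mult_right_mono sum_nonneg) (use ac in auto)
    also have "\<dots> < (L + 1) * (e / (L + 1))"
      using L d by (intro mult_strict_left_mono) auto
    finally show "(\<Sum>i<n. norm (f (c i) - f (a i))) < e" using L by simp
  qed
qed

lemma lipschitz_in_W12:
  fixes f :: "real \<Rightarrow> 'b::euclidean_space"
  assumes "L-lipschitz_on {0..T} f" "0 \<le> T" "AE t in lebesgue_on {0..T}. f differentiable (at t)"
  shows "f \<in> W12 T"
proof -
  have "AE t in lebesgue_on {0..T}. (f has_vector_derivative vector_derivative f (at t)) (at t)"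
    using assms(3) by (simp add: vector_derivative_works)
  note D = lipschitz_AE_derivative[OF assms(1,2) this]
  have "integrable (lebesgue_on {0..T}) (\<lambda>t. (norm (vector_derivative f (at t)))\<^sup>2)"
  proof (rule integrable_lebesgue_on_bounded)
    show "(\<lambda>t. (norm (vector_derivative f (at t)))\<^sup>2) \<in> borel_measurable (lebesgue_on {0..T})"
      using D(1) by measurable
    show "AE t in lebesgue_on {0..T}. norm ((norm (vector_derivative f (at t)))\<^sup>2) \<le> L\<^sup>2"
      using D(2) by eventually_elim (simp add: power_mono)
  qed
  then show ?thesis
    using assms abs_continuous_upto_lipschitz D(1) by (auto simp: W12_def)
qed

text \<open>The integral formula is applied to the difference on \<open>{0..t}\<close>, and the
  domain is then enlarged under a nonnegative integrand. The bound no longer depends on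
  \<open>t\<close>, so L^1 convergence of derivatives yields uniform convergence.\<close>

lemma lipschitz_diff_le_integral_derivative_diff:
  fixes f g :: "real \<Rightarrow> 'b::euclidean_space"
  assumes "0 \<le> T" "K-lipschitz_on {0..T} f" "L-lipschitz_on {0..T} g" "f 0 = g 0"
    and f: "AE t in lebesgue_on {0..T}. (f has_vector_derivative f' t) (at t)"
    and g: "AE t in lebesgue_on {0..T}. (g has_vector_derivative g' t) (at t)"
    and t: "t \<in> {0..T}"
  shows "norm (f t - g t) \<le> (LINT s|lebesgue_on {0..T}. norm (f' s - g' s))"
proof -
  have lip: "(K + L)-lipschitz_on {0..T} (\<lambda>s. f s - g s)"
    using assms by (intro lipschitz_on_diff)
  have der: "AE t in lebesgue_on {0..T}. ((\<lambda>s. f s - g s) has_vector_derivative (f' t - g' t)) (at t)"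
    using f g by eventually_elim (rule has_vector_derivative_diff)
  note D = lipschitz_AE_derivative[OF lip assms(1) der]
  have int: "integrable (lebesgue_on {0..T}) (\<lambda>s. norm (f' s - g' s))"
    by (rule integrable_norm integrable_lebesgue_on_bounded)+ (use D in auto)
  have "norm (f t - g t) = norm (LINT s|lebesgue_on {0..t}. f' s - g' s)"
    using D(3)[OF t] assms(4) by simp
  also have "\<dots> \<le> (LINT s|lebesgue_on {0..t}. norm (f' s - g' s))"
    by (rule integral_norm_bound)
  also have "\<dots> = (LINT s:{0..t}|lebesgue. norm (f' s - g' s))"
    by (simp add: integral_restrict_space set_lebesgue_integral_def)
  also have "\<dots> \<le> (LINT s:{0..T}|lebesgue. norm (f' s - g' s))"
    unfolding set_lebesgue_integral_def
  proof (rule integral_mono')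
    show "integrable lebesgue (\<lambda>s. indicator {0..T} s *\<^sub>R norm (f' s - g' s))"
      using int by (simp add: integrable_restrict_space)
  qed (use t in \<open>auto simp: indicator_def\<close>)
  also have "\<dots> = (LINT s|lebesgue_on {0..T}. norm (f' s - g' s))"
    by (simp add: integral_restrict_space set_lebesgue_integral_def)
  finally show ?thesis .
qed

text \<open>Dominated convergence with the constant majorants \<open>B + L\<close> and its square.
  The Lipschitz constants of the \<open>f k\<close> may vary with \<open>k\<close>: they only give
  access to the integral formula, while the uniform bound comes from \<open>B\<close>.\<close>

lemma uniform_convergence_of_AE_derivative:
  fixes f f' :: "nat \<Rightarrow> real \<Rightarrow> 'b::euclidean_space" and g :: "real \<Rightarrow> 'b"
  assumes "0 \<le> T" "\<And>k. \<exists>K. K-lipschitz_on {0..T} (f k)" "L-lipschitz_on {0..T} g" "\<And>k. f k 0 = g 0"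
    and f: "\<And>k. AE t in lebesgue_on {0..T}. (f k has_vector_derivative f' k t) (at t) \<and> norm (f' k t) \<le> B"
    and g: "AE t in lebesgue_on {0..T}. (g has_vector_derivative g' t) (at t)"
    and lim: "AE t in lebesgue_on {0..T}. (\<lambda>k. f' k t) \<longlonglongrightarrow> g' t"
  shows "(\<lambda>k. LINT s|lebesgue_on {0..T}. norm (f' k s - g' s)) \<longlonglongrightarrow> 0"
    and "(\<lambda>k. LINT s|lebesgue_on {0..T}. (norm (f' k s - g' s))\<^sup>2) \<longlonglongrightarrow> 0"
    and "\<And>k t. t \<in> {0..T} \<Longrightarrow> norm (f k t - g t) \<le> (LINT s|lebesgue_on {0..T}. norm (f' k s - g' s))"
proof -
  have f1: "AE t in lebesgue_on {0..T}. (f k has_vector_derivative f' k t) (at t)" for k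
    using f[of k] by eventually_elim simp
  have fm: "f' k \<in> borel_measurable (lebesgue_on {0..T})" for k
    using lipschitz_AE_derivative(1)[OF _ assms(1) f1] assms(2) by blast
  note gD = lipschitz_AE_derivative(1,2)[OF assms(3,1) g]
  have bound: "AE t in lebesgue_on {0..T}. norm (f' k t - g' t) \<le> B + L" for k
    using f[of k] gD(2) by eventually_elim (intro order_trans[OF norm_triangle_ineq4] add_mono, auto)
  have const: "integrable (lebesgue_on {0..T}) (\<lambda>_. c)" for c :: real
    by (rule finite_measure.integrable_const[OF finite_measure_lebesgue_on_Icc])
  have "(\<lambda>k. LINT s|lebesgue_on {0..T}. norm (f' k s - g' s)) \<longlonglongrightarrow> (LINT s|lebesgue_on {0..T}. 0)"
  proof (rule integral_dominated_convergence[where w="\<lambda>_. B + L"])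
    show "AE t in lebesgue_on {0..T}. (\<lambda>k. norm (f' k t - g' t)) \<longlonglongrightarrow> 0"
      using lim by eventually_elim (rule tendsto_norm_zero[OF LIM_zero])
  qed (use fm gD(1) bound const in auto)
  then show "(\<lambda>k. LINT s|lebesgue_on {0..T}. norm (f' k s - g' s)) \<longlonglongrightarrow> 0" by simp
  have "(\<lambda>k. LINT s|lebesgue_on {0..T}. (norm (f' k s - g' s))\<^sup>2) \<longlonglongrightarrow> (LINT s|lebesgue_on {0..T}. 0)"
  proof (rule integral_dominated_convergence[where w="\<lambda>_. (B + L)\<^sup>2"])
    show "AE t in lebesgue_on {0..T}. (\<lambda>k. (norm (f' k t - g' t))\<^sup>2) \<longlonglongrightarrow> 0"
      using lim
    proof eventually_elim
      case (elim t)
      then have "(\<lambda>k. (norm (f' k t - g' t))\<^sup>2) \<longlonglongrightarrow> 0\<^sup>2"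
        by (intro tendsto_power tendsto_norm_zero LIM_zero)
      then show ?case by simp
    qed
    show "AE t in lebesgue_on {0..T}. norm ((norm (f' k t - g' t))\<^sup>2) \<le> (B + L)\<^sup>2" for k
      using bound[of k] by eventually_elim (simp add: power_mono)
    show "(\<lambda>s. (norm (f' k s - g' s))\<^sup>2) \<in> borel_measurable (lebesgue_on {0..T})" for k
      using fm[of k] gD(1) by measurable
  qed (use const in auto)
  then show "(\<lambda>k. LINT s|lebesgue_on {0..T}. (norm (f' k s - g' s))\<^sup>2) \<longlonglongrightarrow> 0" by simp
  show "norm (f k t - g t) \<le> (LINT s|lebesgue_on {0..T}. norm (f' k s - g' s))" if "t \<in> {0..T}" for k t
    using that assms(2)[of k] lipschitz_diff_le_integral_derivative_diff[OF assms(1) _ assms(3,4) f1 g] by blast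
qed

text \<open>The function part of the squared norm is at most \<open>T\<close> times the squared L^1
  distance of the derivatives, by the uniform estimate; the derivative part is their squared L^2
  distance.\<close>

lemma W12_convergesI:
  fixes f f' :: "nat \<Rightarrow> real \<Rightarrow> 'b::euclidean_space" and g :: "real \<Rightarrow> 'b"
  assumes "0 \<le> T" "\<And>k. \<exists>K. K-lipschitz_on {0..T} (f k)" "L-lipschitz_on {0..T} g" "\<And>k. f k 0 = g 0"
    and f: "\<And>k. AE t in lebesgue_on {0..T}. (f k has_vector_derivative f' k t) (at t) \<and> norm (f' k t) \<le> B"
    and g: "AE t in lebesgue_on {0..T}. (g has_vector_derivative g' t) (at t)"
    and lim: "AE t in lebesgue_on {0..T}. (\<lambda>k. f' k t) \<longlonglongrightarrow> g' t"
  shows "W12_converges T f g"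
proof -
  note C = uniform_convergence_of_AE_derivative[OF assms]
  let ?I = "\<lambda>k. LINT s|lebesgue_on {0..T}. norm (f' k s - g' s)"
  have fW: "f k \<in> W12 T" for k
  proof -
    have "AE t in lebesgue_on {0..T}. f k differentiable (at t)"
      using f[of k] by eventually_elim (auto intro: differentiableI_vector)
    then show ?thesis using assms(1,2) lipschitz_in_W12 by blast
  qed
  have gW: "g \<in> W12 T"
  proof -
    have "AE t in lebesgue_on {0..T}. g differentiable (at t)"
      using g by eventually_elim (auto intro: differentiableI_vector)
    then show ?thesis using assms(1,3) lipschitz_in_W12 by blast
  qed
  have I1: "(LINT t|lebesgue_on {0..T}. (norm (f k t - g t))\<^sup>2) \<le> T * (?I k)\<^sup>2" for k
  proof -
    have "(LINT t|lebesgue_on {0..T}. (norm (f k t - g t))\<^sup>2) \<le> (LINT t|lebesgue_on {0..T}. (?I k)\<^sup>2)"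
    proof (rule integral_mono')
      show "integrable (lebesgue_on {0..T}) (\<lambda>t. (?I k)\<^sup>2)"
        by (rule finite_measure.integrable_const[OF finite_measure_lebesgue_on_Icc])
      show "(norm (f k t - g t))\<^sup>2 \<le> (?I k)\<^sup>2" if "t \<in> space (lebesgue_on {0..T})" for t
        using that C(3)[of t k] by (auto intro!: power_mono)
    qed auto
    also have "\<dots> = T * (?I k)\<^sup>2"
      using assms(1) by (simp add: measure_restrict_space)
    finally show ?thesis .
  qed
  \<comment> \<open>At points of non-differentiability \<open>vector_derivative\<close> has an
    unspecified value, so equality with \<open>f' k - g'\<close> holds only almost everywhere and
    measurability has to be carried over along it.\<close>
  have I2: "(LINT t|lebesgue_on {0..T}. (norm (vector_derivative (\<lambda>t. f k t - g t) (at t)))\<^sup>2)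
      = (LINT s|lebesgue_on {0..T}. (norm (f' k s - g' s))\<^sup>2)" for k
  proof -
    have ae: "AE t in lebesgue_on {0..T}. vector_derivative (\<lambda>t. f k t - g t) (at t) = f' k t - g' t"
      using f[of k] g by eventually_elim (auto intro!: vector_derivative_at has_vector_derivative_diff)
    have "\<exists>K. K-lipschitz_on {0..T} (\<lambda>t. f k t - g t)"
      using assms(2)[of k] assms(3) lipschitz_on_diff by blast
    moreover have d: "AE t in lebesgue_on {0..T}. ((\<lambda>t. f k t - g t) has_vector_derivative (f' k t - g' t)) (at t)"
      using f[of k] g by eventually_elim (auto intro!: has_vector_derivative_diff)
    ultimately have m: "(\<lambda>t. f' k t - g' t) \<in> borel_measurable (lebesgue_on {0..T})"
      using lipschitz_AE_derivative(1)[OF _ assms(1) d] by blast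
    have m': "(\<lambda>t. vector_derivative (\<lambda>t. f k t - g t) (at t)) \<in> borel_measurable (lebesgue_on {0..T})"
      by (rule borel_measurable_lebesgue_on_AE[OF m]) (use ae in \<open>auto elim!: eventually_mono\<close>)
    show ?thesis
      by (rule integral_cong_AE) (use m m' ae in \<open>auto elim!: eventually_mono\<close>)
  qed
  have "(\<lambda>k. W12_norm T (\<lambda>t. f k t - g t)) \<longlonglongrightarrow> 0"
  proof (rule Lim_null_comparison)
    show "eventually (\<lambda>k. norm (W12_norm T (\<lambda>t. f k t - g t))
      \<le> sqrt (T * (?I k)\<^sup>2 + (LINT s|lebesgue_on {0..T}. (norm (f' k s - g' s))\<^sup>2))) sequentially"
    proof (rule always_eventually, rule allI)
      fix k
      have "W12_norm T (\<lambda>t. f k t - g t) \<ge> 0"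
        unfolding W12_norm_def by (intro real_sqrt_ge_zero add_nonneg_nonneg Bochner_Integration.integral_nonneg) auto
      then show "norm (W12_norm T (\<lambda>t. f k t - g t))
        \<le> sqrt (T * (?I k)\<^sup>2 + (LINT s|lebesgue_on {0..T}. (norm (f' k s - g' s))\<^sup>2))"
        using I1[of k] unfolding W12_norm_def I2 by simp
    qed
    have "(\<lambda>k. sqrt (T * (?I k)\<^sup>2 + (LINT s|lebesgue_on {0..T}. (norm (f' k s - g' s))\<^sup>2))) \<longlonglongrightarrow> sqrt (T * 0\<^sup>2 + 0)"
      by (intro tendsto_intros C)
    then show "(\<lambda>k. sqrt (T * (?I k)\<^sup>2 + (LINT s|lebesgue_on {0..T}. (norm (f' k s - g' s))\<^sup>2))) \<longlonglongrightarrow> 0"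
      by simp
  qed
  then show ?thesis using fW gW by (simp add: W12_converges_def)
qed

subsection \<open>Meshes and polygons\<close>

lemma is_mesh_mono:
  assumes "is_mesh T N s" "i \<le> j" "j \<le> N"
  shows "s i \<le> s j"
  using assms(2,3)
proof (induction j rule: dec_induct)
  case (step n)
  then have "s n < s (Suc n)" using assms(1) by (simp add: is_mesh_def)
  with step show ?case by simp
qed simp

lemma is_mesh_bounds:
  assumes "is_mesh T N s" "j \<le> N"
  shows "s j \<in> {0..T}"
  using is_mesh_mono[OF assms(1), of 0 j] is_mesh_mono[OF assms(1), of j N] assms
  by (simp add: is_mesh_def)

lemma mesh_size_ge: "j < N \<Longrightarrow> s (Suc j) - s j \<le> mesh_size N s"
  unfolding mesh_size_def by (rule Max_ge) auto

lemma is_mesh_bracket: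
  assumes "is_mesh T N s" "t \<in> {0<..<T}" "t \<notin> s ` {..N}"
  shows "\<exists>j<N. s j < t \<and> t < s (Suc j)"
proof -
  have "\<exists>j\<le>N. t < s j" using assms by (intro exI[of _ N]) (auto simp: is_mesh_def)
  define j where "j = (LEAST j. t < s j)"
  have "t < s j" and "j \<le> N"
    unfolding j_def using \<open>\<exists>j\<le>N. t < s j\<close> by (auto intro: LeastI_ex Least_le order_trans)
  moreover have "j \<noteq> 0"
    using \<open>t < s j\<close> assms by (auto simp: is_mesh_def intro: gr0I)
  then obtain i where "j = Suc i" using not0_implies_Suc by blast
  moreover have "\<not> t < s i" using not_less_Least[of i "\<lambda>j. t < s j"] \<open>j = Suc i\<close> by (simp add: j_def)
  moreover have "t \<noteq> s i" using assms(3) \<open>j \<le> N\<close> \<open>j = Suc i\<close> by auto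
  ultimately show ?thesis by (intro exI[of _ i]) auto
qed

text \<open>The nodes of all meshes together form a countable set, so almost every \<open>t\<close>
  is strictly inside a cell of every mesh at once; \<open>J k t\<close> is the index of that cell.
  Strictness is what differentiating a polygon and the straddling quotients require.\<close>

lemma AE_mesh_brackets:
  assumes mesh: "\<And>k. is_mesh T (N k) (s k)"
    and size: "(\<lambda>k. mesh_size (N k) (s k)) \<longlonglongrightarrow> 0"
  obtains J :: "nat \<Rightarrow> real \<Rightarrow> nat" where
    "AE t in lebesgue_on {0..T}. 0 < t \<and>
       (\<forall>k. J k t < N k \<and> s k (J k t) < t \<and> t < s k (Suc (J k t))) \<and>
       (\<lambda>k. s k (J k t)) \<longlonglongrightarrow> t \<and> (\<lambda>k. s k (Suc (J k t))) \<longlonglongrightarrow> t"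
proof
  let ?J = "\<lambda>k t. SOME j. j < N k \<and> s k j < t \<and> t < s k (Suc j)"
  have "countable (\<Union>k. s k ` {..N k})" by (intro countable_UN) auto
  then have "AE t in lebesgue_on {0..T}. t \<notin> (\<Union>k. s k ` {..N k})"
    by (rule AE_lebesgue_on_countable) auto
  then show "AE t in lebesgue_on {0..T}. 0 < t \<and>
       (\<forall>k. ?J k t < N k \<and> s k (?J k t) < t \<and> t < s k (Suc (?J k t))) \<and>
       (\<lambda>k. s k (?J k t)) \<longlonglongrightarrow> t \<and> (\<lambda>k. s k (Suc (?J k t))) \<longlonglongrightarrow> t"
    using AE_lebesgue_on_interior_interval[of 0 T]
  proof eventually_elim
    case (elim t)
    have J: "?J k t < N k \<and> s k (?J k t) < t \<and> t < s k (Suc (?J k t))" for k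
      by (rule someI_ex) (use is_mesh_bracket[OF mesh[of k], of t] elim in auto)
    have gap: "s k (Suc (?J k t)) - s k (?J k t) \<le> mesh_size (N k) (s k)" for k
      by (rule mesh_size_ge) (use J in blast)
    have "\<bar>s k (?J k t) - t\<bar> \<le> mesh_size (N k) (s k)" "\<bar>s k (Suc (?J k t)) - t\<bar> \<le> mesh_size (N k) (s k)" for k
      using J[of k] gap[of k] by linarith+
    then have "(\<lambda>k. s k (?J k t) - t) \<longlonglongrightarrow> 0" "(\<lambda>k. s k (Suc (?J k t)) - t) \<longlonglongrightarrow> 0"
      by (auto intro!: Lim_null_comparison[OF _ size] always_eventually)
    with J elim show ?case by (auto simp: LIM_zero_iff)
  qed
qed

text \<open>Each interior node of a uniform grid is moved to the right by less than half a step, to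
  a point satisfying \<open>P\<close>. Cells then have lengths between one half and three halves of
  the step. The endpoints stay at 0 and \<open>T\<close>, where \<open>P\<close> may fail.\<close>

lemma decreasing_meshes_through:
  assumes P: "AE t in lebesgue_on {0..T}. P t" and "0 < T"
  obtains N :: "nat \<Rightarrow> nat" and s :: "nat \<Rightarrow> nat \<Rightarrow> real" where
    "\<And>k. is_mesh T (N k) (s k)" "decreases_to_0 (\<lambda>k. mesh_size (N k) (s k))"
    "\<And>k j. 0 < j \<Longrightarrow> j < N k \<Longrightarrow> P (s k j)"
proof -
  \<comment> \<open>Division of the step by 4 makes the mesh sizes monotone: the largest possible
    new cell, 3/8 of the old step, is below the smallest possible old one, 1/2 of it.\<close>
  define N :: "nat \<Rightarrow> nat" where "N k = 4 ^ Suc k" for k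
  define h where "h k = T / real (N k)" for k
  have N0: "N k > 0" for k by (simp add: N_def)
  have h0: "h k > 0" for k using \<open>0 < T\<close> N0 by (simp add: h_def)
  have hS: "h (Suc k) = h k / 4" for k by (simp add: h_def N_def)
  have hN: "real (N k) * h k = T" for k using N0[of k] by (simp add: h_def)
  have hlim: "h \<longlonglongrightarrow> 0"
  proof -
    have "h = (\<lambda>k. T / 4 * (1 / 4) ^ k)" by (simp add: h_def N_def fun_eq_iff power_divide)
    moreover have "(\<lambda>k. T / 4 * (1 / 4) ^ k) \<longlonglongrightarrow> T / 4 * 0"
      by (intro tendsto_mult tendsto_const LIMSEQ_power_zero) auto
    ultimately show ?thesis by simp
  qed
  define r where "r k j = (SOME t. real j * h k < t \<and> t < (real j + 1/2) * h k \<and> P t)" for k j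
  have r: "real j * h k < r k j \<and> r k j < (real j + 1/2) * h k \<and> P (r k j)" if "j < N k" for j k
    unfolding r_def
  proof (rule someI_ex, rule AE_lebesgue_on_exists[OF P])
    show "real j * h k < (real j + 1/2) * h k" using h0[of k] by (simp add: algebra_simps)
    have "(real j + 1/2) * h k \<le> real (N k) * h k"
      using that h0[of k] by (intro mult_right_mono) auto
    moreover have "0 \<le> real j * h k" using h0[of k] by simp
    ultimately show "{real j * h k<..<(real j + 1/2) * h k} \<subseteq> {0..T}"
      unfolding hN by (meson atLeastAtMost_iff greaterThanLessThan_iff less_imp_le order_trans subsetI)
  qed simp
  define s where "s k j = (if j = 0 then 0 else if j = N k then T else r k j)" for k j
  have s: "real j * h k \<le> s k j \<and> s k j \<le> (real j + 1/2) * h k" if "j \<le> N k" for k j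
  proof -
    have "j = 0 \<or> j = N k \<and> j \<noteq> 0 \<or> j \<noteq> 0 \<and> j < N k" using that by linarith
    then show ?thesis
    proof (elim disjE conjE)
      assume "j = 0"
      then show ?thesis using h0[of k] by (simp add: s_def)
    next
      assume "j = N k" "j \<noteq> 0"
      then show ?thesis using h0[of k] hN[of k] unfolding s_def distrib_right by simp
    next
      assume "j \<noteq> 0" "j < N k"
      then show ?thesis using r[of j k] by (simp add: s_def)
    qed
  qed
  have gap: "h k / 2 \<le> s k (Suc j) - s k j \<and> s k (Suc j) - s k j \<le> 3/2 * h k" if "j < N k" for k j
    using s[of j k] s[of "Suc j" k] that by (simp add: distrib_right)
  have size: "h k / 2 \<le> mesh_size (N k) (s k)" "mesh_size (N k) (s k) \<le> 3/2 * h k" for k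
  proof -
    show "h k / 2 \<le> mesh_size (N k) (s k)"
      using gap[OF N0[of k]] mesh_size_ge[OF N0[of k], of "s k"] by linarith
    show "mesh_size (N k) (s k) \<le> 3/2 * h k"
      unfolding mesh_size_def
    proof (rule Max.boundedI)
      fix a assume "a \<in> (\<lambda>j. s k (Suc j) - s k j) ` {..<N k}"
      then obtain j where "j < N k" "a = s k (Suc j) - s k j" by blast
      with gap[OF this(1)] show "a \<le> 3/2 * h k" by simp
    qed (use N0[of k] in auto)
  qed
  show thesis
  proof (rule that)
    show "is_mesh T (N k) (s k)" for k
      unfolding is_mesh_def
    proof (intro conjI allI impI)
      show "s k 0 = 0" "s k (N k) = T" using N0[of k] by (auto simp: s_def)
      show "s k j < s k (Suc j)" if "j < N k" for j using gap[OF that] h0[of k] by linarith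
    qed
    have "decseq (\<lambda>k. mesh_size (N k) (s k))"
    proof (rule decseq_SucI)
      fix k
      show "mesh_size (N (Suc k)) (s (Suc k)) \<le> mesh_size (N k) (s k)"
        using size(2)[of "Suc k"] size(1)[of k] h0[of k] hS[of k] by linarith
    qed
    moreover have "(\<lambda>k. mesh_size (N k) (s k)) \<longlonglongrightarrow> 0"
    proof (rule tendsto_sandwich)
      show "\<forall>\<^sub>F k in sequentially. 0 \<le> mesh_size (N k) (s k)"
      proof (rule always_eventually, rule allI)
        fix k show "0 \<le> mesh_size (N k) (s k)" using size(1)[of k] h0[of k] by linarith
      qed
      show "\<forall>\<^sub>F k in sequentially. mesh_size (N k) (s k) \<le> 3/2 * h k"
        by (rule always_eventually, rule allI, rule size(2))
      show "(\<lambda>k. 3/2 * h k) \<longlonglongrightarrow> 0"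
        using tendsto_mult[OF tendsto_const hlim, of "3/2"] by simp
    qed auto
    ultimately show "decreases_to_0 (\<lambda>k. mesh_size (N k) (s k))" by (simp add: decreases_to_0_def)
    show "P (s k j)" if "0 < j" "j < N k" for k j using r[OF that(2)] that by (simp add: s_def)
  qed
qed

section \<open>Divided differences and polygons\<close>

definition slope :: "(nat \<Rightarrow> real) \<Rightarrow> (nat \<Rightarrow> 'b::real_vector) \<Rightarrow> nat \<Rightarrow> 'b" where
  "slope s p j = (p (Suc j) - p j) /\<^sub>R (s (Suc j) - s j)"

text \<open>This is the linear interpolant of the values \<open>p j\<close> at the nodes
  \<open>s j\<close>, written as a sum of clamped ramps: ramp \<open>i\<close> is zero before its
  cell and constant after it. One formula for all \<open>t\<close> avoids gluing at the
  nodes.\<close>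

definition polygon :: "nat \<Rightarrow> (nat \<Rightarrow> real) \<Rightarrow> (nat \<Rightarrow> 'b::real_vector) \<Rightarrow> real \<Rightarrow> 'b" where
  "polygon N s p t = p 0 + (\<Sum>i<N. max 0 (min (s (Suc i) - s i) (t - s i)) *\<^sub>R slope s p i)"

text \<open>Ramps of earlier cells are saturated and telescope to \<open>p j - p 0\<close>, those of
  later cells have not started, and only ramp \<open>j\<close> varies.\<close>

lemma polygon_on_cell:
  assumes mesh: "is_mesh T N s" and "j < N" and t: "t \<in> {s j..s (Suc j)}"
  shows "polygon N s p t = p j + (t - s j) *\<^sub>R slope s p j"
proof -
  let ?c = "\<lambda>i. max 0 (min (s (Suc i) - s i) (t - s i)) *\<^sub>R slope s p i"
  have lt: "s i < s (Suc i)" if "i < N" for i using mesh that by (simp add: is_mesh_def)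
  have "{..<N} = {..<j} \<union> ({j} \<union> {Suc j..<N})" using \<open>j < N\<close> by auto
  then have "sum ?c {..<N} = sum ?c ({..<j} \<union> ({j} \<union> {Suc j..<N}))" by (rule arg_cong)
  also have "\<dots> = sum ?c {..<j} + sum ?c ({j} \<union> {Suc j..<N})" by (rule sum.union_disjoint) auto
  also have "sum ?c ({j} \<union> {Suc j..<N}) = sum ?c {j} + sum ?c {Suc j..<N}" by (rule sum.union_disjoint) auto
  finally have split: "sum ?c {..<N} = sum ?c {..<j} + (sum ?c {j} + sum ?c {Suc j..<N})" .
  have "sum ?c {..<j} = (\<Sum>i<j. p (Suc i) - p i)"
  proof (rule sum.cong)
    fix i assume "i \<in> {..<j}"
    then have "s (Suc i) \<le> t" "s i < s (Suc i)"
      using is_mesh_mono[OF mesh, of "Suc i" j] lt[of i] t \<open>j < N\<close> by auto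
    then show "?c i = p (Suc i) - p i" by (simp add: slope_def)
  qed simp
  then have before: "sum ?c {..<j} = p j - p 0" by (simp only: sum_lessThan_telescope)
  have after: "sum ?c {Suc j..<N} = 0"
  proof (rule sum.neutral, rule ballI)
    fix i assume "i \<in> {Suc j..<N}"
    then have "t \<le> s i" "s i < s (Suc i)"
      using is_mesh_mono[OF mesh, of "Suc j" i] lt[of i] t by auto
    then show "?c i = 0" by simp
  qed
  have "sum ?c {j} = (t - s j) *\<^sub>R slope s p j" using t by simp
  with split before after show ?thesis by (simp only: polygon_def) simp
qed

lemma polygon_at_node:
  assumes "is_mesh T N s" "j \<le> N"
  shows "polygon N s p (s j) = p j"
proof (cases "j < N")
  case True
  then show ?thesis using polygon_on_cell[OF assms(1) True, of "s j" p] assms(1) by (simp add: is_mesh_def less_imp_le)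
next
  case False
  then have "j = N" using assms(2) by simp
  show ?thesis
  proof (cases N)
    case 0
    then show ?thesis using \<open>j = N\<close> by (simp add: polygon_def)
  next
    case (Suc n)
    then have lt: "s n < s (Suc n)" using assms(1) unfolding is_mesh_def by blast
    show ?thesis
      using polygon_on_cell[OF assms(1), of n "s (Suc n)" p] lt Suc \<open>j = N\<close> by (simp add: slope_def)
  qed
qed

lemma polygon_has_vector_derivative:
  fixes p :: "nat \<Rightarrow> 'b::real_normed_vector"
  assumes "is_mesh T N s" "j < N" "s j < t" "t < s (Suc j)"
  shows "(polygon N s p has_vector_derivative slope s p j) (at t)"
proof (rule has_vector_derivative_transform_within_open[of _ _ _ "{s j<..<s (Suc j)}"])
  show "((\<lambda>t. p j + (t - s j) *\<^sub>R slope s p j) has_vector_derivative slope s p j) (at t)"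
    by (auto intro!: derivative_eq_intros)
  show "p j + (r - s j) *\<^sub>R slope s p j = polygon N s p r" if "r \<in> {s j<..<s (Suc j)}" for r
    using polygon_on_cell[OF assms(1,2), of r p] that by simp
qed (use assms in auto)

text \<open>Clamping is nonexpansive, so each ramp is Lipschitz with the norm of its slope as
  constant.\<close>

lemma polygon_lipschitz:
  fixes p :: "nat \<Rightarrow> 'b::real_normed_vector"
  shows "\<exists>K. K-lipschitz_on S (polygon N s p)"
proof -
  have "\<exists>K. K-lipschitz_on S (\<lambda>t. \<Sum>i<n. max 0 (min (s (Suc i) - s i) (t - s i)) *\<^sub>R slope s p i)" for n
  proof (induction n)
    case 0
    show ?case by (auto intro!: exI[of _ 0] lipschitz_on_constant)
  next
    case (Suc n)
    have "(norm (slope s p n))-lipschitz_on S (\<lambda>t. max 0 (min (s (Suc n) - s n) (t - s n)) *\<^sub>R slope s p n)"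
    proof (rule lipschitz_onI)
      fix x y
      have "dist (max 0 (min (s (Suc n) - s n) (x - s n)) *\<^sub>R slope s p n)
           (max 0 (min (s (Suc n) - s n) (y - s n)) *\<^sub>R slope s p n)
        = \<bar>max 0 (min (s (Suc n) - s n) (x - s n)) - max 0 (min (s (Suc n) - s n) (y - s n))\<bar> * norm (slope s p n)"
        by (simp only: dist_norm flip: scaleR_diff_left) simp
      also have "\<dots> \<le> \<bar>x - y\<bar> * norm (slope s p n)"
        by (intro mult_right_mono) auto
      finally show "dist (max 0 (min (s (Suc n) - s n) (x - s n)) *\<^sub>R slope s p n)
           (max 0 (min (s (Suc n) - s n) (y - s n)) *\<^sub>R slope s p n) \<le> norm (slope s p n) * dist x y"
        by (simp add: dist_real_def mult.commute)
    qed simp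
    with Suc show ?case by (auto intro: lipschitz_on_add)
  qed
  then obtain K where "K-lipschitz_on S (\<lambda>t. \<Sum>i<N. max 0 (min (s (Suc i) - s i) (t - s i)) *\<^sub>R slope s p i)"
    by blast
  from lipschitz_on_add[OF lipschitz_on_constant this]
  show ?thesis unfolding polygon_def by blast
qed

lemma slope_Pair: "slope s (\<lambda>j. (p j, q j)) j = (slope s p j, slope s q j)"
  by (simp add: slope_def)

lemma polygon_Pair: "polygon N s (\<lambda>j. (p j, q j)) t = (polygon N s p t, polygon N s q t)"
proof -
  have "(\<Sum>i<n. c i *\<^sub>R (a i, b i)) = (\<Sum>i<n. c i *\<^sub>R a i, \<Sum>i<n. c i *\<^sub>R b i)"
    for n :: nat and c :: "nat \<Rightarrow> real" and a :: "nat \<Rightarrow> 'a" and b :: "nat \<Rightarrow> 'b"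
    by (induction n) (simp_all add: zero_prod_def)
  then show ?thesis by (simp add: polygon_def slope_Pair)
qed

lemma slope_add: "slope s (\<lambda>j. p j + q j) j = slope s p j + slope s q j"
  by (simp add: slope_def scaleR_add_right[symmetric] add_diff_add)

lemma slope_diff: "slope s (\<lambda>j. p j - q j) j = slope s p j - slope s q j"
  by (simp add: slope_def scaleR_diff_right[symmetric])

text \<open>The discrete product rule; one factor is taken at the right end of the cell, which is
  why the error at \<open>Suc j\<close> appears later.\<close>

lemma slope_bilinear:
  assumes "bounded_bilinear mul"
  shows "slope s (\<lambda>j. mul (p j) (q j)) j = mul (slope s p j) (q (Suc j)) + mul (p j) (slope s q j)"
proof -
  interpret bounded_bilinear mul by fact
  have "mul (p (Suc j)) (q (Suc j)) - mul (p j) (q j)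
      = mul (p (Suc j) - p j) (q (Suc j)) + mul (p j) (q (Suc j) - q j)"
    by (simp add: diff_left diff_right)
  then show ?thesis by (simp add: slope_def scaleR_left scaleR_right scaleR_add_right)
qed

lemma slope_partial_sums:
  assumes "s j < s (Suc j)"
  shows "slope s (\<lambda>j. x0 + (\<Sum>i<j. (s (Suc i) - s i) *\<^sub>R v i)) j = v j"
  using assms by (simp add: slope_def)

lemma slope_samples_le:
  fixes f :: "real \<Rightarrow> 'b::real_normed_vector"
  assumes "L-lipschitz_on {0..T} f" "is_mesh T N s" "j < N"
  shows "norm (slope s (\<lambda>j. f (s j)) j) \<le> L"
  unfolding slope_def using assms is_mesh_bounds[OF assms(2)]
  by (intro lipschitz_on_quotient_le[OF assms(1)]) auto

subsection \<open>Translated polyhedra\<close>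

definition row_inner :: "(real^'n)^'m \<Rightarrow> real^'n \<Rightarrow> real^'m" where
  "row_inner u e = (\<chi> i. (u $ i) \<bullet> e)"

lemma bounded_bilinear_row_inner: "bounded_bilinear row_inner"
proof -
  have "bilinear (row_inner :: (real^'n)^'m \<Rightarrow> _)"
    unfolding bilinear_def row_inner_def
    by (auto intro!: linearI simp: vec_eq_iff inner_add_left inner_add_right)
  then show ?thesis by (simp add: bilinear_conv_bounded_bilinear)
qed

text \<open>Adding the inner product of row \<open>i\<close> with \<open>e\<close> to the bound
  \<open>b $ i\<close> shifts that half-space by \<open>e\<close>. The point moves along, so the
  case of an empty cone is preserved as well.\<close>

lemma normal_cone_translated_polyhedron:
  "normal_cone (polyhedron_of u (b + row_inner u e)) (x + e) = normal_cone (polyhedron_of u b) x"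
proof -
  have *: "y \<in> polyhedron_of u (b + row_inner u e) \<longleftrightarrow> y - e \<in> polyhedron_of u b" for y
    by (simp add: polyhedron_of_def row_inner_def inner_diff_right algebra_simps)
  have "(\<forall>y\<in>polyhedron_of u (b + row_inner u e). v \<bullet> (y - (x + e)) \<le> 0)
      \<longleftrightarrow> (\<forall>y\<in>polyhedron_of u b. v \<bullet> (y - x) \<le> 0)" for v
  proof
    assume l: "\<forall>y\<in>polyhedron_of u (b + row_inner u e). v \<bullet> (y - (x + e)) \<le> 0"
    show "\<forall>y\<in>polyhedron_of u b. v \<bullet> (y - x) \<le> 0"
    proof
      fix y assume "y \<in> polyhedron_of u b"
      then show "v \<bullet> (y - x) \<le> 0" using l[rule_format, of "y + e"] by (simp add: *)
    qed
  next
    assume "\<forall>y\<in>polyhedron_of u b. v \<bullet> (y - x) \<le> 0"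
    then have "v \<bullet> (y - e - x) \<le> 0" if "y - e \<in> polyhedron_of u b" for y
      using that by blast
    then show "\<forall>y\<in>polyhedron_of u (b + row_inner u e). v \<bullet> (y - (x + e)) \<le> 0"
      by (simp add: * diff_diff_eq add.commute[of e])
  qed
  then show ?thesis by (simp add: normal_cone_def *)
qed

subsection \<open>The discrete approximation\<close>

theorem theorem5:
  fixes T :: real
    and x0 :: "real^'n"
    and ubar :: "real \<Rightarrow> (real^'n)^'m"
    and bbar :: "real \<Rightarrow> real^'m"
    and xbar :: "real \<Rightarrow> real^'n"
  assumes "T > 0"
    and "x0 \<in> polyhedron_of (ubar 0) (bbar 0)"
    and "canonical_control T x0 ubar bbar"
    and "sweeping_solution T ubar bbar x0 xbar"
  shows "\<exists>(\<nu> :: nat \<Rightarrow> nat) (\<tau> :: nat \<Rightarrow> nat \<Rightarrow> real)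
           (u :: nat \<Rightarrow> real \<Rightarrow> (real^'n)^'m) (b :: nat \<Rightarrow> real \<Rightarrow> real^'m)
           (x :: nat \<Rightarrow> real \<Rightarrow> real^'n) (v :: nat \<Rightarrow> nat \<Rightarrow> real^'n) (\<delta> :: nat \<Rightarrow> real).
      (\<forall>k. is_mesh T (\<nu> k) (\<tau> k))
    \<and> decreases_to_0 (\<lambda>k. mesh_size (\<nu> k) (\<tau> k))
    \<and> (\<forall>k. piecewise_linear_on_mesh (\<nu> k) (\<tau> k) (\<lambda>t. (u k t, b k t, x k t)))
    \<and> (\<forall>k. \<delta> k > 0) \<and> decreases_to_0 \<delta>
    \<and> (\<forall>k. (u k 0, b k 0, x k 0) = (ubar 0, bbar 0, x0))
    \<and> (\<forall>k. \<forall>j\<le>\<nu> k. \<forall>i. 1 - \<delta> k \<le> norm (u k (\<tau> k j) $ i) \<and> norm (u k (\<tau> k j) $ i) \<le> 1 + \<delta> k)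
    \<and> (\<forall>k. \<forall>j<\<nu> k.
          (\<forall>t\<in>{\<tau> k j..\<tau> k (Suc j)}. x k t = x k (\<tau> k j) + (t - \<tau> k j) *\<^sub>R v k j)
        \<and> - v k j \<in> sweeping_map (u k (\<tau> k j)) (b k (\<tau> k j)) (x k (\<tau> k j)))
    \<and> W12_converges T (\<lambda>k t. (u k t, b k t, x k t)) (\<lambda>t. (ubar t, bbar t, xbar t))"
proof -
  note canon = assms(3)[unfolded canonical_control_def]
  have T0: "0 \<le> T" using \<open>T > 0\<close> by simp
  obtain Lu Lb Lx where lip: "Lu-lipschitz_on {0..T} ubar" "Lb-lipschitz_on {0..T} bbar" "Lx-lipschitz_on {0..T} xbar"
    using canon assms(4) unfolding sweeping_solution_def by blast
  have x00: "xbar 0 = x0" using assms(4) by (simp add: sweeping_solution_def)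
  have unit: "norm (ubar t $ i) = 1" if "t \<in> {0..T}" for t i using canon that by blast
  obtain du where du: "AE t in lebesgue_on {0..T}. (ubar has_vector_derivative du t) (at t)"
    using canon unfolding has_BV_derivative_def by blast
  obtain db where db: "AE t in lebesgue_on {0..T}. (bbar has_vector_derivative db t) (at t)"
    using canon unfolding has_BV_derivative_def by blast
  obtain y g where y: "\<forall>z. sweeping_solution T ubar bbar x0 z \<longrightarrow> (\<forall>t\<in>{0..T}. z t = y t)"
    and g: "bounded_variation_upto T g" "AE t in lebesgue_on {0..T}. (y has_vector_derivative g t) (at t)"
    using canon unfolding has_BV_derivative_def by blast
  have xy: "xbar t = y t" if "t \<in> {0..T}" for t using y assms(4) that by blast
  \<comment> \<open>Uniqueness identifies \<open>xbar\<close> with \<open>y\<close> only on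
    \<open>{0..T}\<close>, so the two-sided derivative is transferred at interior points.\<close>
  have dx: "AE t in lebesgue_on {0..T}. (xbar has_vector_derivative g t) (at t)"
    using g(2) AE_lebesgue_on_interior_interval[of 0 T]
  proof eventually_elim
    case (elim t)
    show ?case
      by (rule has_vector_derivative_transform_within_open[OF elim(1), of "{0<..<T}"])
        (use elim xy in auto)
  qed
  obtain M where M: "\<And>t. t \<in> {0..T} \<Longrightarrow> norm (g t) \<le> M"
    using AE_continuous_if_bounded_variation_upto(2)[OF g(1) T0] by blast
  have M0: "0 \<le> M" using M[of 0] T0 norm_ge_zero[of "g 0"] by (auto simp del: norm_ge_zero)

  \<comment> \<open>Stated with the representative \<open>g\<close>, because its point values become
    the discrete velocities.\<close>
  define good where "good t \<longleftrightarrow> - g t \<in> normal_cone (polyhedron_of (ubar t) (bbar t)) (xbar t)" for t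
  have "AE t in lebesgue_on {0..T}. xbar differentiable (at t)
          \<and> - vector_derivative xbar (at t) \<in> normal_cone (polyhedron_of (ubar t) (bbar t)) (xbar t)"
    using assms(4) by (simp add: sweeping_solution_def)
  then have "AE t in lebesgue_on {0..T}. good t"
    using dx by eventually_elim (auto simp: good_def vector_derivative_at)
  then obtain N s where mesh: "\<And>k. is_mesh T (N k) (s k)"
    and size: "decreases_to_0 (\<lambda>k. mesh_size (N k) (s k))"
    and good: "\<And>k j. 0 < j \<Longrightarrow> j < N k \<Longrightarrow> good (s k j)"
    using decreasing_meshes_through \<open>T > 0\<close> by blast
  have s0: "s k 0 = 0" for k using mesh[of k] by (simp add: is_mesh_def)
  have lt: "s k j < s k (Suc j)" if "j < N k" for k j using mesh[of k] that by (simp add: is_mesh_def)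
  have sT: "s k j \<in> {0..T}" if "j \<le> N k" for k j using is_mesh_bounds[OF mesh that] .
  obtain J where J: "AE t in lebesgue_on {0..T}. 0 < t \<and>
       (\<forall>k. J k t < N k \<and> s k (J k t) < t \<and> t < s k (Suc (J k t))) \<and>
       (\<lambda>k. s k (J k t)) \<longlonglongrightarrow> t \<and> (\<lambda>k. s k (Suc (J k t))) \<longlonglongrightarrow> t"
    using AE_mesh_brackets[of T N s, OF mesh conjunct2[OF size[unfolded decreases_to_0_def]]] by blast

  text \<open>The first velocity is zero because \<open>t = 0\<close> need not be a good time.\<close>
  define v where "v k j = (if j = 0 then 0 else g (s k j))" for k j
  define X where "X k j = x0 + (\<Sum>i<j. (s k (Suc i) - s k i) *\<^sub>R v k i)" for k j
  have slopeX: "slope (s k) (X k) j = v k j" if "j < N k" for k j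
    unfolding X_def by (rule slope_partial_sums[OF lt[OF that]])
  have vM: "norm (v k j) \<le> M" if "j < N k" for k j
    using M[OF sT[of j k]] M0 that by (simp add: v_def)
  have vlim: "AE t in lebesgue_on {0..T}. (\<lambda>k. v k (J k t)) \<longlonglongrightarrow> g t"
    using J AE_continuous_if_bounded_variation_upto(1)[OF g(1) T0] AE_lebesgue_on_interior_interval[of 0 T]
  proof eventually_elim
    case (elim t)
    have lim: "filterlim (\<lambda>k. s k (J k t)) (at t within {0..T}) sequentially"
      unfolding filterlim_at using elim sT
      by (intro conjI always_eventually allI) (auto simp: less_imp_le, metis less_irrefl)
    have "(g \<longlongrightarrow> g t) (at t within {0..T})" using elim(2) by (simp add: continuous_within)
    from filterlim_compose[OF this lim] have glim: "(\<lambda>k. g (s k (J k t))) \<longlonglongrightarrow> g t" .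
    \<comment> \<open>As \<open>t > 0\<close>, the cell around \<open>t\<close> is eventually not
      the first one, and the artificial zero velocity no longer interferes.\<close>
    have "eventually (\<lambda>k. s k (J k t) > 0) sequentially"
      using elim by (intro order_tendstoD(1)[of _ t]) auto
    then have "eventually (\<lambda>k. g (s k (J k t)) = v k (J k t)) sequentially"
      by eventually_elim (auto simp: v_def s0)
    with glim show ?case by (rule Lim_transform_eventually)
  qed
  define \<epsilon> where "\<epsilon> k = (LINT t|lebesgue_on {0..T}. norm (v k (J k t) - g t))" for k
  have dX: "AE t in lebesgue_on {0..T}. (polygon (N k) (s k) (X k) has_vector_derivative v k (J k t)) (at t)
      \<and> norm (v k (J k t)) \<le> M" for k
    using J
  proof eventually_elim
    case (elim t)
    then have "J k t < N k" "s k (J k t) < t" "t < s k (Suc (J k t))" by auto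
    from polygon_has_vector_derivative[OF mesh this, of "X k"] slopeX[OF this(1)] vM[OF this(1)]
    show ?case by simp
  qed
  have X0: "polygon (N k) (s k) (X k) 0 = xbar 0" for k
    using polygon_at_node[OF mesh, of 0 k "X k"] by (simp add: s0 X_def x00)
  note conv = uniform_convergence_of_AE_derivative[of T "\<lambda>k. polygon (N k) (s k) (X k)",
      OF T0 polygon_lipschitz lip(3) X0 dX dx vlim, folded \<epsilon>_def]
  define e where "e k j = X k j - xbar (s k j)" for k j
  have e_le: "norm (e k j) \<le> \<epsilon> k" if "j \<le> N k" for k j
    using conv(3)[of "s k j" k] sT[OF that] polygon_at_node[OF mesh that, of "X k"] by (simp add: e_def)
  \<comment> \<open>A bound on the errors uniform in \<open>k\<close> and \<open>j\<close> is needed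
    for a common bound on the slopes of the corrected \<open>b\<close>.\<close>
  have "Bseq \<epsilon>" using conv(1) by (intro convergent_imp_Bseq) (auto simp: convergent_def)
  then obtain E where E: "\<And>k. norm (\<epsilon> k) \<le> E" unfolding Bseq_def by blast
  have eE: "norm (e k j) \<le> E" if "j \<le> N k" for k j
    using e_le[OF that] E[of k] by simp
  have slope_e: "slope (s k) (e k) j = v k j - slope (s k) (\<lambda>j. xbar (s k j)) j" if "j < N k" for k j
    unfolding e_def slope_diff slopeX[OF that] ..

  \<comment> \<open>The corrected controls and the convergence of their slopes\<close>
  interpret ri: bounded_bilinear "row_inner :: (real^'n)^'m \<Rightarrow> _" by (rule bounded_bilinear_row_inner)
  obtain K where K: "K > 0" "\<And>a c. norm (row_inner (a :: (real^'n)^'m) c) \<le> norm a * norm c * K"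
    using ri.pos_bounded by blast
  define U where "U k j = ubar (s k j)" for k j
  define B where "B k j = bbar (s k j) + row_inner (U k j) (e k j)" for k j
  define f where "f k = polygon (N k) (s k) (\<lambda>j. (U k j, B k j, X k j))" for k
  define df where "df k t = slope (s k) (\<lambda>j. (U k j, B k j, X k j)) (J k t)" for k t
  have f_eq: "f k t = (polygon (N k) (s k) (U k) t, polygon (N k) (s k) (B k) t, polygon (N k) (s k) (X k) t)" for k t
    by (simp add: f_def polygon_Pair)
  \<comment> \<open>The slope of \<open>e\<close> is replaced by a velocity minus a divided
    difference of \<open>xbar\<close>, so no quotient of the small error by the cell length remains
    to be estimated.\<close>
  have slopeB: "slope (s k) (B k) j = slope (s k) (\<lambda>j. bbar (s k j)) j
      + (row_inner (slope (s k) (U k) j) (e k (Suc j))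
      + row_inner (U k j) (v k j - slope (s k) (\<lambda>j. xbar (s k j)) j))" if "j < N k" for k j
    unfolding B_def slope_add slope_bilinear[OF bounded_bilinear_row_inner] slope_e[OF that] ..
  define W where "W = norm (ubar 0) + Lu * T"
  have W: "norm (U k j) \<le> W" if "j \<le> N k" for k j
    unfolding U_def W_def by (rule norm_lipschitz_on_Icc_le[OF lip(1) sT[OF that]])
  \<comment> \<open>The sum of the bounds for the slopes of \<open>U\<close>, \<open>B\<close> and
    \<open>X\<close>; the middle group follows the three terms of \<open>slopeB\<close>.\<close>
  define C where "C = Lu + (Lb + (Lu * E * K + W * (M + Lx) * K) + M)"
  have slope_le: "norm (slope (s k) (\<lambda>j. (U k j, B k j, X k j)) j) \<le> C" if j: "j < N k" for k j
  proof -
    have u: "norm (slope (s k) (U k) j) \<le> Lu"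
      unfolding U_def by (rule slope_samples_le[OF lip(1) mesh j])
    have b: "norm (slope (s k) (\<lambda>j. bbar (s k j)) j) \<le> Lb"
      by (rule slope_samples_le[OF lip(2) mesh j])
    have x: "norm (slope (s k) (\<lambda>j. xbar (s k j)) j) \<le> Lx"
      by (rule slope_samples_le[OF lip(3) mesh j])
    have w: "norm (U k j) \<le> W" using W j by simp
    have "norm (row_inner (slope (s k) (U k) j) (e k (Suc j))) \<le> norm (slope (s k) (U k) j) * norm (e k (Suc j)) * K"
      by (rule K)
    also have "\<dots> \<le> Lu * E * K"
      using u eE[of "Suc j" k] j K(1) lipschitz_on_nonneg[OF lip(1)] by (intro mult_right_mono mult_mono) auto
    finally have 1: "norm (row_inner (slope (s k) (U k) j) (e k (Suc j))) \<le> Lu * E * K" .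
    have vx: "norm (v k j - slope (s k) (\<lambda>j. xbar (s k j)) j) \<le> M + Lx"
      using norm_triangle_ineq4 vM[OF j] x by (rule order_trans[OF _ add_mono])
    have "norm (row_inner (U k j) (v k j - slope (s k) (\<lambda>j. xbar (s k j)) j))
        \<le> norm (U k j) * norm (v k j - slope (s k) (\<lambda>j. xbar (s k j)) j) * K"
      by (rule K)
    also have "\<dots> \<le> W * (M + Lx) * K"
      using w vx K(1) order_trans[OF norm_ge_zero w] by (intro mult_right_mono mult_mono) auto
    finally have 2: "norm (row_inner (U k j) (v k j - slope (s k) (\<lambda>j. xbar (s k j)) j)) \<le> W * (M + Lx) * K" .
    have "norm (slope (s k) (B k) j) \<le> Lb + (Lu * E * K + W * (M + Lx) * K)"
      unfolding slopeB[OF j] by (intro norm_triangle_le add_mono b 1 2)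
    moreover have "norm (slope (s k) (X k) j) \<le> M" using slopeX[OF j] vM[OF j] by simp
    moreover have "norm (a, c, d) \<le> norm a + (norm c + norm d)" for a :: "(real^'n)^'m" and c :: "real^'m" and d :: "real^'n"
      using norm_Pair_le[of a "(c, d)"] norm_Pair_le[of c d] by linarith
    ultimately show ?thesis
      unfolding slope_Pair C_def using u by (meson add_mono order_trans)
  qed
  have df: "AE t in lebesgue_on {0..T}. (f k has_vector_derivative df k t) (at t) \<and> norm (df k t) \<le> C" for k
    using J
  proof eventually_elim
    case (elim t)
    then have "J k t < N k" "s k (J k t) < t" "t < s k (Suc (J k t))" by auto
    from polygon_has_vector_derivative[OF mesh this] slope_le[OF this(1)]
    show ?case unfolding f_def df_def by blast
  qed
  have dlim: "AE t in lebesgue_on {0..T}. (\<lambda>k. df k t) \<longlonglongrightarrow> (du t, db t, g t)"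
    using J du db dx vlim
  proof eventually_elim
    case (elim t)
    have JN: "J k t < N k" for k using elim(1) by blast
    have br: "\<And>k. s k (J k t) < t" "\<And>k. t < s k (Suc (J k t))"
      "(\<lambda>k. s k (J k t)) \<longlonglongrightarrow> t" "(\<lambda>k. s k (Suc (J k t))) \<longlonglongrightarrow> t"
      using elim(1) by auto
    have u: "(\<lambda>k. slope (s k) (U k) (J k t)) \<longlonglongrightarrow> du t"
      unfolding slope_def U_def by (rule tendsto_straddling_quotient[OF elim(2) br])
    have b: "(\<lambda>k. slope (s k) (\<lambda>j. bbar (s k j)) (J k t)) \<longlonglongrightarrow> db t"
      unfolding slope_def by (rule tendsto_straddling_quotient[OF elim(3) br])
    have x: "(\<lambda>k. slope (s k) (\<lambda>j. xbar (s k j)) (J k t)) \<longlonglongrightarrow> g t"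
      unfolding slope_def by (rule tendsto_straddling_quotient[OF elim(4) br])
    have "(\<lambda>k. e k (Suc (J k t))) \<longlonglongrightarrow> 0"
      by (rule Lim_null_comparison[OF _ conv(1)]) (use e_le JN in \<open>auto intro!: always_eventually simp: Suc_le_eq\<close>)
    from ri.tendsto[OF u this]
    have 1: "(\<lambda>k. row_inner (slope (s k) (U k) (J k t)) (e k (Suc (J k t)))) \<longlonglongrightarrow> 0"
      by (simp add: ri.zero_right)
    have "isCont ubar t" using elim(2) by (rule has_vector_derivative_continuous)
    then have "(\<lambda>k. U k (J k t)) \<longlonglongrightarrow> ubar t"
      unfolding U_def using br(3) by (rule isCont_tendsto_compose)
    from ri.tendsto[OF this tendsto_diff[OF elim(5) x]]
    have 2: "(\<lambda>k. row_inner (U k (J k t)) (v k (J k t) - slope (s k) (\<lambda>j. xbar (s k j)) (J k t))) \<longlonglongrightarrow> 0"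
      by (simp add: ri.zero_right)
    have "(\<lambda>k. slope (s k) (B k) (J k t)) \<longlonglongrightarrow> db t"
      unfolding slopeB[OF JN] using tendsto_add[OF b tendsto_add[OF 1 2]] by simp
    then show ?case
      unfolding df_def slope_Pair slopeX[OF JN] by (intro tendsto_Pair u elim(5))
  qed
  have dbar: "AE t in lebesgue_on {0..T}. ((\<lambda>t. (ubar t, bbar t, xbar t)) has_vector_derivative (du t, db t, g t)) (at t)"
    using du db dx by eventually_elim (intro has_vector_derivative_Pair)
  have node: "f k (s k j) = (U k j, B k j, X k j)" if "j \<le> N k" for k j
    unfolding f_def by (rule polygon_at_node[OF mesh that])
  \<comment> \<open>The error vanishes at time 0, so the initial value of \<open>b\<close> is not
    corrected.\<close>
  have node0: "f k 0 = (ubar 0, bbar 0, x0)" for k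
    using node[of 0 k] by (simp add: s0 U_def B_def X_def e_def x00 ri.zero_right)
  have "W12_converges T f (\<lambda>t. (ubar t, bbar t, xbar t))"
  proof (rule W12_convergesI[OF T0 _ _ _ df dbar dlim])
    show "\<exists>K. K-lipschitz_on {0..T} (f k)" for k unfolding f_def by (rule polygon_lipschitz)
    show "(sqrt (Lu\<^sup>2 + (sqrt (Lb\<^sup>2 + Lx\<^sup>2))\<^sup>2))-lipschitz_on {0..T} (\<lambda>t. (ubar t, bbar t, xbar t))"
      by (intro lipschitz_on_Pair lip)
    show "f k 0 = (ubar 0, bbar 0, xbar 0)" for k by (simp add: node0 x00)
  qed
  moreover have "- v k j \<in> sweeping_map (U k j) (B k j) (X k j)" if "j < N k" for k j
  proof (cases "j = 0")
    \<comment> \<open>Zero is a normal at every feasible point, and without a correction at time 0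
      feasibility is the assumption on \<open>x0\<close>.\<close>
    case True
    then show ?thesis
      using assms(2) by (simp add: sweeping_map_def normal_cone_def v_def U_def B_def X_def e_def s0 x00 ri.zero_right)
  next
    case False
    then have "- v k j \<in> normal_cone (polyhedron_of (U k j) (bbar (s k j))) (xbar (s k j))"
      using good[of j k] that by (simp add: good_def v_def U_def)
    moreover have "X k j = xbar (s k j) + e k j" by (simp add: e_def)
    ultimately show ?thesis
      unfolding sweeping_map_def B_def by (simp only: normal_cone_translated_polyhedron)
  qed
  moreover have "piecewise_linear_on_mesh (N k) (s k) (f k)" for k
    unfolding piecewise_linear_on_mesh_def
  proof (intro allI impI exI ballI)
    fix j t assume "j < N k" "t \<in> {s k j..s k (Suc j)}"
    then show "f k t = f k (s k j) + (t - s k j) *\<^sub>R slope (s k) (\<lambda>j. (U k j, B k j, X k j)) j"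
      using node[of j k] polygon_on_cell[OF mesh] by (simp add: f_def)
  qed
  moreover have "snd (snd (f k t)) = X k j + (t - s k j) *\<^sub>R v k j"
    if "j < N k" "t \<in> {s k j..s k (Suc j)}" for k j t
    using polygon_on_cell[OF mesh that, of "X k"] slopeX[OF that(1)] by (simp add: f_eq)
  \<comment> \<open>The rows have norm exactly one at the nodes, so any positive sequence decreasing
    to 0 can serve as \<delta>.\<close>
  moreover have "decreases_to_0 (\<lambda>k. 1 / real (Suc k))"
    unfolding decreases_to_0_def
    using LIMSEQ_inverse_real_of_nat by (auto simp: decseq_def inverse_eq_divide frac_le)
  moreover have "norm (U k j $ i) = 1" if "j \<le> N k" for k j i
    unfolding U_def using unit sT[OF that] by blast
  ultimately show ?thesis
    using mesh size node node0
    by (intro exI[of _ N] exI[of _ s] exI[of _ "\<lambda>k t. fst (f k t)"] exI[of _ "\<lambda>k t. fst (snd (f k t))"]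
        exI[of _ "\<lambda>k t. snd (snd (f k t))"] exI[of _ v] exI[of _ "\<lambda>k. 1 / real (Suc k)"])
      (simp add: less_imp_le)
qed

end
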